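(* Let $1\le r<\infty$, $\gamma\in\mathbb{R}\setminus\{0\}$, $0<q<\infty$, and $f\in C_c^1(\mathbb{R}^n)$. For $x\in\mathbb{R}^n$ and $\lambda>0$ define $$\widetilde E_{x,r}(f,\lambda,q,\gamma):=\left\{y\in\mathbb{R}^n:m_f^{(r)}(x,|x-y|)>\lambda|x-y|^{1+\gamma/q}\right\}.$$ Then, for every $x\in\mathbb{R}^n$, $$\lim_{\lambda\to\infty}\lambda\left(\int_{\widetilde E_{x,r}(f,\lambda,q,\gamma)}|x-y|^{\gamma-n}\,dy\right)^{1/q}=\frac{|\mathbb S^{n-1}|^{1/q}\tilde K_{n,r}}{\gamma^{1/q}}|\nabla f(x)|\quad\text{if }\gamma>0,$$ $$\lim_{\lambda\to0^+}\lambda\left(\int_{\widetilde E_{x,r}(f,\lambda,q,\gamma)}|x-y|^{\gamma-n}\,dy\right)^{1/q}=\frac{|\mathbb S^{n-1}|^{1/q}\tilde K_{n,r}}{(-\gamma)^{1/q}}|\nabla f(x)|\quad\text{if }\gamma<0.$$ Moreover, there is a constant $C_{n,r}$ depending only on $n$ and $r$ such that $$\sup_{\lambda>0}\lambda\left(\int_{\widetilde E_{x,r}(f,\lambda,q,\gamma)}|x-y|^{\gamma-n}\,dy\right)^{1/q}\le C_{n,r}|\mathbb S^{n-1}|^{1/q}|\gamma|^{-1/q}\bigl[M(|\nabla f|^r)(x)\bigr]^{1/r}.$$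
   Context: For $t>0$, $m_f^{(r)}(x,t):=\left(\frac1{|B(x,t)|}\int_{B(x,t)}|f(y)-f_{B(x,t)}|^r\,dy\right)^{1/r}$, where $f_{B(x,t)}=\frac1{|B(x,t)|}\int_{B(x,t)}f(y)\,dy$. $\tilde K_{n,r}:=\left(\frac1{|B(0,1)|}\int_{B(0,1)}|e\cdot z|^r\,dz\right)^{1/r}$ for any unit vector $e$ (independent of $e$). $Mg(x):=\sup_{t>0}\frac1{|B(x,t)|}\int_{B(x,t)}|g(y)|\,dy$ is the centered Hardy–Littlewood maximal function. *)

theory Defs
  imports "HOL-Analysis.Analysis"
begin

definition grad :: "('a::real_inner \<Rightarrow> real) \<Rightarrow> 'a \<Rightarrow> 'a" where
  "grad f x = (THE D. GDERIV f x :> D)"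

definition C1_compact_support :: "('a::euclidean_space \<Rightarrow> real) \<Rightarrow> bool" where
  "C1_compact_support f \<longleftrightarrow>
     (\<forall>x. f differentiable (at x)) \<and> continuous_on UNIV (grad f) \<and> compact (closure {x. f x \<noteq> 0})"

definition ball_average :: "('a::euclidean_space \<Rightarrow> real) \<Rightarrow> 'a \<Rightarrow> real \<Rightarrow> real" where
  "ball_average f x t = 1 / measure lborel (ball x t) * (LINT y:ball x t|lborel. f y)"

definition mean_osc :: "real \<Rightarrow> ('a::euclidean_space \<Rightarrow> real) \<Rightarrow> 'a \<Rightarrow> real \<Rightarrow> real" where
  "mean_osc r f x t = ball_average (\<lambda>y. \<bar>f y - ball_average f x t\<bar> powr r) x t powr (1 / r)"

definition K_const :: "'a::euclidean_space \<Rightarrow> real \<Rightarrow> real" where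
  "K_const e r = ball_average (\<lambda>z. \<bar>e \<bullet> z\<bar> powr r) 0 1 powr (1 / r)"

definition HL_maximal :: "('a::euclidean_space \<Rightarrow> real) \<Rightarrow> 'a \<Rightarrow> ennreal" where
  "HL_maximal g x =
     (SUP t\<in>{0<..}. (\<integral>\<^sup>+y\<in>ball x t. ennreal \<bar>g y\<bar> \<partial>lborel) / emeasure lborel (ball x t))"

text \<open>The point \<open>y = x\<close> is never a member: both sides of the strict inequality are \<open>0\<close> there.\<close>
definition E_set ::
  "'a::euclidean_space \<Rightarrow> real \<Rightarrow> ('a \<Rightarrow> real) \<Rightarrow> real \<Rightarrow> real \<Rightarrow> real \<Rightarrow> 'a set" where
  "E_set x r f lam q \<gamma> =
     {y. mean_osc r f x (norm (x - y)) > lam * norm (x - y) powr (1 + \<gamma> / q)}"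

text \<open>Surface measure of a subset of the unit sphere, normalised as in polar coordinates:
  the dimension times the Lebesgue measure of the cone over the set.  In dimension one this is
  the counting measure on the two-point sphere.\<close>
definition sphere_measure :: "'a::euclidean_space set \<Rightarrow> real" where
  "sphere_measure A =
     real DIM('a) * measure lborel {t *\<^sub>R \<theta> | t \<theta>. 0 < t \<and> t < 1 \<and> \<theta> \<in> A}"

text \<open>Powers of extended nonnegative reals; only meant for exponents \<open>p > 0\<close>.\<close>
definition ennreal_powr :: "ennreal \<Rightarrow> real \<Rightarrow> ennreal" where
  "ennreal_powr a p = (if a = \<infinity> then \<infinity> else ennreal (enn2real a powr p))"

text \<open>The quantity under study, with values in \<open>[0, \<infinity>]\<close>, so that bounds on it include
  finiteness of the integral.\<close>
definition E_functional ::
  "'a::euclidean_space \<Rightarrow> real \<Rightarrow> ('a \<Rightarrow> real) \<Rightarrow> real \<Rightarrow> real \<Rightarrow> real \<Rightarrow> ennreal" where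
  "E_functional x r f lam q \<gamma> =
     ennreal lam * ennreal_powr
       (\<integral>\<^sup>+y\<in>E_set x r f lam q \<gamma>. ennreal (norm (x - y) powr (\<gamma> - real DIM('a))) \<partial>lborel)
       (1 / q)"

end

(* Membership of y in the level set depends only on t = |x - y| and says that
   lam * t powr (gamma / q) < g t, where g t = mean_osc r f x t / t.  For a constant c in place of
   g t, polar coordinates give lam^q times the integral the value |S^(n-1)| / |gamma| * c^q,
   whatever the sign of gamma.  Hence the theorem follows from two facts about g.

   As t tends to 0, g t tends to K_const e r * |grad f x|: after rescaling to the unit ball this is
   dominated convergence for the difference quotients of f, together with rotation invariance.

   For every t, g t is at most 2 * M(|grad f|^r)(x)^(1/r): replacing the average of f by f x costs a
   factor 2, and |f (x + t z) - f x|^r is at most t^r times the integral over s in [0,1] of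
   |grad f (x + s t z)|^r, whose average over z is an average of |grad f|^r over the ball of radius
   s t about x.

   In the limit only radii with g t close to its limit at 0 matter: the remaining ones, t >= delta,
   do not meet the level set for large lam if gamma > 0, and carry a finite mass, hence contribute
   O(lam^q), if gamma < 0. *)
theory Submission
  imports Defs "HOL-Probability.Probability"
begin

section \<open>Polar coordinates for radial integrands\<close>

text \<open>The cone over the whole sphere is the open unit ball without its centre, and a point is
  a null set.\<close>

lemma sphere_measure_unit_sphere:
  "sphere_measure (sphere (0 :: 'a::euclidean_space) 1) = real DIM('a) * unit_ball_vol DIM('a)"
proof -
  have "{t *\<^sub>R \<theta> | t \<theta>. 0 < t \<and> t < 1 \<and> \<theta> \<in> sphere (0::'a) 1} = ball 0 1 - {0}"
  proof (intro equalityI subsetI)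
    fix y :: 'a assume "y \<in> ball 0 1 - {0}"
    then show "y \<in> {t *\<^sub>R \<theta> | t \<theta>. 0 < t \<and> t < 1 \<and> \<theta> \<in> sphere (0::'a) 1}"
      by (auto intro!: exI[of _ "norm y"] exI[of _ "y /\<^sub>R norm y"])
  qed auto
  moreover have "measure lborel (ball (0::'a) 1 - {0}) = measure lborel (ball (0::'a) 1)"
    by (rule measure_Diff_null_set) auto
  moreover have "measure lborel (ball (0::'a) 1) = unit_ball_vol DIM('a)"
    by (subst content_ball) auto
  ultimately show ?thesis
    by (simp add: sphere_measure_def)
qed

text \<open>Polar coordinates for functions of the distance to \<open>x\<close>. The half-lines
  \<open>{..a}\<close> determine both measures: on the left they give the volume of
  \<open>cball x a\<close>, on the right the integral of its derivative in the radius.\<close>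

lemma distr_lborel_norm:
  fixes x :: "'a::euclidean_space"
  shows "distr lborel borel (\<lambda>y. norm (x - y)) =
    density lborel (\<lambda>t. ennreal (indicator {0..} t * (sphere_measure (sphere (0::'a) 1) * t ^ (DIM('a) - 1))))"
    (is "?M = density lborel ?g")
proof (rule measure_eqI_generator_eq[where E="range (\<lambda>a::real. {..a})" and \<Omega>=UNIV and A="\<lambda>i. {..real i}"])
  define n where "n = DIM('a)"
  have n: "0 < n" by (simp add: n_def)
  have M: "emeasure ?M {..a} = ennreal (if a < 0 then 0 else unit_ball_vol n * a ^ n)" for a
  proof -
    have "emeasure ?M {..a} = emeasure lborel (cball x a)"
      by (subst emeasure_distr) (auto intro!: arg_cong[where f="emeasure lborel"] simp: dist_norm)
    then show ?thesis
      by (auto simp: emeasure_cball n_def)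
  qed
  have N: "emeasure (density lborel ?g) {..a} = ennreal (if a < 0 then 0 else unit_ball_vol n * a ^ n)" for a
  proof (cases "a < 0")
    case True
    then have "\<And>t. ?g t * indicator {..a} t = 0" by (auto simp: indicator_def)
    then have "(\<integral>\<^sup>+ t. ?g t * indicator {..a} t \<partial>lborel) = (\<integral>\<^sup>+ (t::real). 0 \<partial>lborel)"
      by (intro nn_integral_cong)
    with True show ?thesis by (subst emeasure_density) simp_all
  next
    case False
    \<comment> \<open>The boundary term at 0 vanishes because the dimension is positive.\<close>
    have "((\<lambda>t. n * unit_ball_vol n * t ^ (n - 1)) has_integral (unit_ball_vol n * a ^ n - unit_ball_vol n * 0 ^ n)) {0..a}"
      using False n
      by (intro fundamental_theorem_of_calculus)
         (auto intro!: derivative_eq_intros simp: has_real_derivative_iff_has_vector_derivative[symmetric])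
    then have "(\<integral>\<^sup>+ t. indicator {0..a} t * (n * unit_ball_vol n * t ^ (n - 1)) \<partial>lborel)
        = ennreal (unit_ball_vol n * a ^ n)"
      using n False by (subst nn_integral_has_integral_lebesgue) (auto simp: power_0_left)
    moreover have "?g t * indicator {..a} t = ennreal (indicator {0..a} t * (n * unit_ball_vol n * t ^ (n - 1)))" for t
      by (auto simp: indicator_def n_def sphere_measure_unit_sphere)
    ultimately show ?thesis
      using False by (simp add: emeasure_density)
  qed
  show "emeasure ?M X = emeasure (density lborel ?g) X" if "X \<in> range (\<lambda>a::real. {..a})" for X
    using that by (elim imageE) (simp only: M N)
  show "emeasure ?M {..real i} \<noteq> \<infinity>" for i by (simp add: M)
  show "Int_stable (range (\<lambda>a::real. {..a}))"
    by (auto simp: Int_stable_def)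
  show "(\<Union>i. {..real i}) = UNIV"
    using real_arch_simple by auto
qed (auto simp: borel_eq_atMost)

lemma nn_integral_radial:
  fixes x :: "'a::euclidean_space"
  assumes [measurable]: "h \<in> borel_measurable borel"
  shows "(\<integral>\<^sup>+ y. h (norm (x - y)) \<partial>lborel) =
    (\<integral>\<^sup>+ t. ennreal (indicator {0..} t * (sphere_measure (sphere (0::'a) 1) * t ^ (DIM('a) - 1))) * h t \<partial>lborel)"
proof -
  have "(\<integral>\<^sup>+ y. h (norm (x - y)) \<partial>lborel) = (\<integral>\<^sup>+ t. h t \<partial>distr lborel borel (\<lambda>y. norm (x - y)))"
    by (subst nn_integral_distr) auto
  then show ?thesis
    unfolding distr_lborel_norm by (simp add: nn_integral_density)
qed

text \<open>The weight of the theorem, integrated over the points whose distance to \<open>x\<close>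
  lies in \<open>T\<close>. For a non-measurable \<open>T\<close> this is a lower integral, which is
  still monotone in \<open>T\<close>.\<close>

definition radial_mass :: "'a::euclidean_space \<Rightarrow> real \<Rightarrow> real set \<Rightarrow> ennreal" where
  "radial_mass x \<gamma> T = (\<integral>\<^sup>+ y. ennreal (norm (x - y) powr (\<gamma> - real DIM('a))) * indicator T (norm (x - y)) \<partial>lborel)"

text \<open>The exponent of the weight and the Jacobian \<open>t ^ (DIM('a) - 1)\<close> add up to
  \<open>\<gamma> - 1\<close> for positive radii; radius 0 is discarded as a null set.\<close>

lemma radial_mass_has_integral:
  fixes x :: "'a::euclidean_space"
  assumes "I \<subseteq> {0..}" and [measurable]: "I \<in> sets borel"
    and "((\<lambda>t. t powr (\<gamma> - 1)) has_integral c) I"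
  shows "radial_mass x \<gamma> I = ennreal (sphere_measure (sphere (0::'a) 1) * c)"
proof -
  let ?S = "sphere_measure (sphere (0::'a) 1)"
  have S: "0 \<le> ?S" by (simp add: sphere_measure_unit_sphere)
  have "radial_mass x \<gamma> I =
    (\<integral>\<^sup>+ t. ennreal (indicator {0..} t * (?S * t ^ (DIM('a) - 1))) *
        (ennreal (t powr (\<gamma> - real DIM('a))) * indicator I t) \<partial>lborel)"
    unfolding radial_mass_def by (subst nn_integral_radial[symmetric]) auto
  also have "\<dots> = (\<integral>\<^sup>+ t. indicator I t * (?S * t powr (\<gamma> - 1)) \<partial>lborel)"
  proof (intro nn_integral_cong_AE)
    have *: "ennreal (indicator {0..} t * (?S * t ^ (DIM('a) - 1))) * (ennreal (t powr (\<gamma> - real DIM('a))) * indicator I t)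
       = ennreal (indicator I t * (?S * t powr (\<gamma> - 1)))" if "t \<noteq> 0" for t
    proof (cases "t \<in> I")
      case True
      with that assms(1) have "0 < t" by force
      then have "t ^ (DIM('a) - 1) * t powr (\<gamma> - real DIM('a)) = t powr (\<gamma> - 1)"
        by (simp add: powr_realpow[symmetric] powr_add[symmetric])
      with True \<open>0 < t\<close> S show ?thesis
        by (simp add: ennreal_mult[symmetric] mult.assoc)
    qed simp
    show "AE t in lborel. ennreal (indicator {0..} t * (?S * t ^ (DIM('a) - 1))) * (ennreal (t powr (\<gamma> - real DIM('a))) * indicator I t)
       = ennreal (indicator I t * (?S * t powr (\<gamma> - 1)))"
      using AE_lborel_singleton[of 0] by eventually_elim (use * in auto)
  qed
  also have "\<dots> = ennreal (?S * c)"
    using has_integral_mult_right[OF assms(3), of ?S] S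
    by (intro nn_integral_has_integral_lebesgue) auto
  finally show ?thesis .
qed

lemma radial_mass_atLeast:
  fixes x :: "'a::euclidean_space"
  assumes "\<gamma> < 0" "0 < a"
  shows "radial_mass x \<gamma> {a..} = ennreal (sphere_measure (sphere (0::'a) 1) * (a powr \<gamma> / (- \<gamma>)))"
  using has_integral_powr_to_inf[of "\<gamma> - 1" a] assms by (intro radial_mass_has_integral) auto

section \<open>Averages over balls as integrals over the unit ball\<close>

lemma emeasure_lborel_affine:
  fixes x :: "'a::euclidean_space"
  assumes "A \<in> sets borel" "c \<noteq> 0"
  shows "emeasure lborel A = ennreal (\<bar>c\<bar> ^ DIM('a)) * emeasure lborel ((\<lambda>z. x + c *\<^sub>R z) -` A)"
  using assms
  by (subst lborel_affine[of c x]) (simp_all add: emeasure_density nn_integral_cmult_indicator emeasure_distr)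

text \<open>All averages over balls are pulled back to this single probability space, so that a
  limit in the radius concerns only the integrand.\<close>

abbreviation uball :: "'a::euclidean_space measure" where
  "uball \<equiv> uniform_measure lborel (ball 0 1)"

lemma emeasure_ball_pos_finite:
  fixes x :: "'a::euclidean_space"
  assumes "0 < t"
  shows "emeasure lborel (ball x t) \<noteq> 0" "emeasure lborel (ball x t) \<noteq> \<infinity>"
proof -
  show "emeasure lborel (ball x t) \<noteq> \<infinity>"
    using emeasure_bounded_finite[of "ball x t"] by auto
  show "emeasure lborel (ball x t) \<noteq> 0"
    using assms unit_ball_vol_pos[of "real DIM('a)", THEN order_less_imp_not_eq2] by (auto simp: emeasure_ball)
qed

lemma prob_space_uball: "prob_space (uball :: 'a::euclidean_space measure)"
  using emeasure_ball_pos_finite[of 1 "0::'a"] by (intro prob_space_uniform_measure) auto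

text \<open>The Jacobian of the affine map occurs in the numerator and in the denominator of the
  uniform measure and cancels.\<close>

lemma uniform_measure_ball_eq_distr:
  fixes x :: "'a::euclidean_space"
  assumes "0 < t"
  shows "uniform_measure lborel (ball x t) = distr uball borel (\<lambda>z. x + t *\<^sub>R z)"
proof (rule measure_eqI)
  fix A :: "'a set" assume "A \<in> sets (uniform_measure lborel (ball x t))"
  then have [measurable]: "A \<in> sets borel" by simp
  let ?h = "\<lambda>z. x + t *\<^sub>R z" and ?c = "ennreal (\<bar>t\<bar> ^ DIM('a))"
  have c: "?c \<noteq> 0" "?c \<noteq> \<infinity>" using assms by auto
  have vim: "?h -` ball x t = ball 0 1"
    using assms by (auto simp: dist_norm)
  have "emeasure (uniform_measure lborel (ball x t)) A
      = emeasure lborel (ball x t \<inter> A) / emeasure lborel (ball x t)"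
    by simp
  also have "\<dots> = (?c * emeasure lborel (ball 0 1 \<inter> ?h -` A)) / (?c * emeasure lborel (ball (0::'a) 1))"
    using assms emeasure_lborel_affine[of "ball x t \<inter> A" t x] emeasure_lborel_affine[of "ball x t" t x]
    by (simp add: vim)
  also have "\<dots> = emeasure lborel (ball 0 1 \<inter> ?h -` A) / emeasure lborel (ball (0::'a) 1)"
    using c by (simp add: divide_mult_eq mult.commute[of ?c])
  also have "\<dots> = emeasure (distr uball borel ?h) A"
    by (simp add: emeasure_distr measurable_sets_borel[of ?h borel A])
  finally show "emeasure (uniform_measure lborel (ball x t)) A = emeasure (distr uball borel ?h) A" .
qed simp

lemma nn_average_ball_eq_uball:
  fixes x :: "'a::euclidean_space"
  assumes "0 < t" and [measurable]: "g \<in> borel_measurable borel"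
  shows "(\<integral>\<^sup>+ y\<in>ball x t. g y \<partial>lborel) / emeasure lborel (ball x t) = (\<integral>\<^sup>+ z. g (x + t *\<^sub>R z) \<partial>uball)"
proof -
  have "(\<integral>\<^sup>+ y\<in>ball x t. g y \<partial>lborel) / emeasure lborel (ball x t) = (\<integral>\<^sup>+ y. g y \<partial>uniform_measure lborel (ball x t))"
    by (simp add: nn_integral_uniform_measure)
  then show ?thesis
    unfolding uniform_measure_ball_eq_distr[OF assms(1)] by (simp add: nn_integral_distr)
qed

lemma ball_average_eq_uball:
  fixes x :: "'a::euclidean_space" and g :: "'a \<Rightarrow> real"
  assumes "0 < t" and [measurable]: "g \<in> borel_measurable borel"
  shows "ball_average g x t = (\<integral> z. g (x + t *\<^sub>R z) \<partial>uball)"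
proof -
  let ?B = "ball x t"
  have m: "emeasure lborel ?B = ennreal (measure lborel ?B)" "0 < measure lborel ?B"
    using emeasure_ball_pos_finite[OF assms(1), of x]
    by (auto simp: emeasure_eq_ennreal_measure zero_less_measure_iff)
  \<comment> \<open>The density is made real-valued so that the Bochner integral can be rewritten by
    it.\<close>
  have dens: "uniform_measure lborel ?B = density lborel (\<lambda>y. ennreal (indicator ?B y / measure lborel ?B))"
    unfolding uniform_measure_def using m
    by (intro arg_cong[where f="density lborel"]) (auto simp: indicator_def divide_ennreal fun_eq_iff simp flip: ennreal_1)
  have "(\<integral> y. g y \<partial>uniform_measure lborel ?B) = (\<integral> y. (indicator ?B y / measure lborel ?B) *\<^sub>R g y \<partial>lborel)"
    unfolding dens 
    by (rule integral_density)
       (auto intro!: borel_measurable_divide borel_measurable_indicator)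
  also have "\<dots> = ball_average g x t"
    by (simp add: ball_average_def set_lebesgue_integral_def)
  finally show ?thesis
    unfolding uniform_measure_ball_eq_distr[OF assms(1)] by (simp add: integral_distr)
qed

lemma mean_osc_eq_uball:
  fixes x :: "'a::euclidean_space" and f :: "'a \<Rightarrow> real"
  assumes "0 < t" and [measurable]: "f \<in> borel_measurable borel"
  shows "mean_osc r f x t =
    (\<integral> z. \<bar>f (x + t *\<^sub>R z) - (\<integral> w. f (x + t *\<^sub>R w) \<partial>uball)\<bar> powr r \<partial>uball) powr (1 / r)"
  using assms by (simp add: mean_osc_def ball_average_eq_uball)

section \<open>Rotation invariance and the constant \<open>K_const\<close>\<close>

text \<open>\<open>T\<close> maps the unit ball to itself, so the claim reduces to invariance of
  Lebesgue measure under \<open>T\<close>, which is derived from translation invariance without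
  determinants.\<close>

lemma integral_uball_orthogonal:
  fixes T :: "'a::euclidean_space \<Rightarrow> 'a" and g :: "'a \<Rightarrow> real"
  assumes T: "orthogonal_transformation T" and [measurable]: "g \<in> borel_measurable borel"
  shows "(\<integral> z. g (T z) \<partial>uball) = (\<integral> z. g z \<partial>uball)"
proof -
  have lin: "linear T" by (rule orthogonal_transformation_linear[OF T])
  have [measurable]: "T \<in> borel_measurable borel"
    by (intro borel_measurable_continuous_onI linear_continuous_on linear_conv_bounded_linear[THEN iffD1] lin)
  define \<mu> where "\<mu> = distr lborel borel T"
  have [measurable_cong]: "sets \<mu> = sets borel" by (simp add: \<mu>_def)
  have vim_ball: "T -` ball 0 s = ball 0 s" for s
    using orthogonal_transformation_norm[OF T] by auto
  have \<mu>_ball: "emeasure \<mu> (ball 0 s) = emeasure lborel (ball (0::'a) s)" for s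
    by (simp add: \<mu>_def emeasure_distr vim_ball)
  \<comment> \<open>Balls of integer radius have finite \<open>\<mu>\<close>-measure and exhaust the
    space; Fubini's theorem for \<open>\<mu>\<close> relies on this.\<close>
  interpret \<mu>: sigma_finite_measure \<mu>
    by standard (rule exI[of _ "range (\<lambda>i::nat. ball 0 (real i))"],
      use \<mu>_ball emeasure_bounded_finite[of "ball (0::'a) _"] in
        \<open>auto simp: \<mu>_def less_top[symmetric] intro!: reals_Archimedean2\<close>)
  interpret pair: pair_sigma_finite \<mu> "lborel :: 'a measure" ..
  have \<mu>_shift: "(\<integral>\<^sup>+ x. h (x + y) \<partial>\<mu>) = (\<integral>\<^sup>+ x. h x \<partial>\<mu>)"
    if [measurable]: "h \<in> borel_measurable borel" for h :: "'a \<Rightarrow> ennreal" and y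
  proof -
    \<comment> \<open>A translation by \<open>y\<close> after \<open>T\<close> is a translation by a
      preimage of \<open>y\<close> before \<open>T\<close>.\<close>
    obtain u where u: "T u = y" using orthogonal_transformation_surj[OF T] by (metis surjD)
    have "(\<integral>\<^sup>+ x. h (x + y) \<partial>\<mu>) = (\<integral>\<^sup>+ x. h (T (u + x)) \<partial>lborel)"
      by (simp add: \<mu>_def nn_integral_distr linear_add[OF lin] u add.commute)
    also have "\<dots> = (\<integral>\<^sup>+ x. h (T x) \<partial>distr lborel borel ((+) u))"
      by (simp add: nn_integral_distr)
    also have "\<dots> = (\<integral>\<^sup>+ x. h x \<partial>\<mu>)"
      by (simp add: lborel_distr_plus \<mu>_def nn_integral_distr)
    finally show ?thesis .
  qed
  have lborel_refl: "(\<integral>\<^sup>+ y. h (x - y) \<partial>lborel) = (\<integral>\<^sup>+ y. h y \<partial>lborel)"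
    if [measurable]: "h \<in> borel_measurable borel" for h :: "'a \<Rightarrow> ennreal" and x
    by (subst (2) lborel_affine[of "-1" x]) (auto simp: nn_integral_density nn_integral_distr)
  have [measurable]: "ball (0::'a) 1 \<in> sets borel" by simp
  \<comment> \<open>Uniqueness of translation-invariant measures: by Fubini and a shear, \<open>\<mu>(A) \<lambda>(B) = \<lambda>(A) \<mu>(B)\<close>;
    here \<open>B\<close> is a ball, on which \<open>\<mu>\<close> and Lebesgue measure \<open>\<lambda>\<close> agree because \<open>T\<close> preserves it.\<close>
  have "emeasure \<mu> A * emeasure lborel (ball (0::'a) 1) = emeasure lborel A * emeasure lborel (ball (0::'a) 1)"
    if [measurable]: "A \<in> sets borel" for A
  proof -
    let ?B = "ball (0::'a) 1"
    have "emeasure \<mu> A * emeasure lborel ?B = (\<integral>\<^sup>+ x. (\<integral>\<^sup>+ y. indicator A x * indicator ?B y \<partial>lborel) \<partial>\<mu>)"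
      by (subst nn_integral_cmult, simp, subst nn_integral_multc) simp_all
    also have "\<dots> = (\<integral>\<^sup>+ x. (\<integral>\<^sup>+ y. indicator A x * indicator ?B (x - y) \<partial>lborel) \<partial>\<mu>)"
      by (intro nn_integral_cong lborel_refl[symmetric]) measurable
    also have "\<dots> = (\<integral>\<^sup>+ y. (\<integral>\<^sup>+ x. indicator A x * indicator ?B (x - y) \<partial>\<mu>) \<partial>lborel)"
      by (rule pair.Fubini'[symmetric]) measurable
    also have "\<dots> = (\<integral>\<^sup>+ y. (\<integral>\<^sup>+ x. indicator A (x + y) * indicator ?B x \<partial>\<mu>) \<partial>lborel)"
    proof (rule nn_integral_cong)
      fix y :: 'a
      show "(\<integral>\<^sup>+ x. indicator A x * indicator ?B (x - y) \<partial>\<mu>) = (\<integral>\<^sup>+ x. indicator A (x + y) * indicator ?B x \<partial>\<mu>)"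
        by (subst \<mu>_shift[symmetric, of _ y]) simp_all
    qed
    also have "\<dots> = (\<integral>\<^sup>+ x. (\<integral>\<^sup>+ y. indicator A (x + y) * indicator ?B x \<partial>lborel) \<partial>\<mu>)"
      by (rule pair.Fubini') measurable
    also have "\<dots> = (\<integral>\<^sup>+ x. (\<integral>\<^sup>+ y. indicator A y * indicator ?B x \<partial>lborel) \<partial>\<mu>)"
    proof (rule nn_integral_cong)
      fix x :: 'a
      have "(\<integral>\<^sup>+ y. indicator A (x + y) * indicator ?B x \<partial>lborel) = (\<integral>\<^sup>+ y. indicator A y * indicator ?B x \<partial>distr lborel borel ((+) x))"
        by (simp add: nn_integral_distr)
      then show "(\<integral>\<^sup>+ y. indicator A (x + y) * indicator ?B x \<partial>lborel) = (\<integral>\<^sup>+ y. indicator A y * indicator ?B x \<partial>lborel)"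
        by (simp add: lborel_distr_plus)
    qed
    also have "\<dots> = emeasure lborel A * emeasure lborel ?B"
      by (subst nn_integral_multc, simp, subst nn_integral_cmult) (simp_all add: \<mu>_ball)
    finally show ?thesis .
  qed
  \<comment> \<open>The volume of the ball is positive and finite and can be cancelled.\<close>
  then have eq: "emeasure \<mu> A = emeasure lborel A" if "A \<in> sets borel" for A
    using that emeasure_ball_pos_finite[of 1 "0::'a"] by (metis infinity_ennreal_def mult_divide_eq_ennreal zero_less_one)
  have "distr uball borel T = uball"
  proof (rule measure_eqI)
    fix A :: "'a set" assume "A \<in> sets (distr uball borel T)"
    then have [measurable]: "A \<in> sets borel" by simp
    have "emeasure lborel (ball 0 1 \<inter> T -` A) = emeasure \<mu> (ball 0 1 \<inter> A)"
      by (simp add: \<mu>_def emeasure_distr vim_ball)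
    then show "emeasure (distr uball borel T) A = emeasure uball A"
      by (simp add: emeasure_distr eq measurable_sets_borel[of T borel A])
  qed simp
  then have "(\<integral> z. g z \<partial>uball) = (\<integral> z. g z \<partial>distr uball borel T)" by simp
  also have "\<dots> = (\<integral> z. g (T z) \<partial>uball)" by (simp add: integral_distr)
  finally show ?thesis by simp
qed

text \<open>The map \<open>z\<close> to \<open>- z\<close> is orthogonal and changes the sign of the
  integrand.\<close>

lemma integral_uball_inner_eq_0:
  fixes v :: "'a::euclidean_space"
  shows "(\<integral> z. v \<bullet> z \<partial>uball) = 0"
proof -
  have "(\<integral> z. v \<bullet> (- z) \<partial>uball) = (\<integral> z. v \<bullet> z \<partial>uball)"
    by (rule integral_uball_orthogonal) (auto simp: orthogonal_transformation_def intro: module_hom_uminus)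
  then show ?thesis by simp
qed

text \<open>A rotation carries \<open>v\<close> to \<open>norm v *\<^sub>R e\<close>, and the length
  comes out by homogeneity. In particular \<open>K_const e r\<close> is the same for all unit
  vectors \<open>e\<close>.\<close>

lemma integral_uball_inner_powr:
  fixes v e :: "real ^ 'n"
  assumes "norm e = 1" "0 < r"
  shows "(\<integral> z. \<bar>v \<bullet> z\<bar> powr r \<partial>uball) powr (1 / r) = K_const e r * norm v"
proof -
  obtain T where T: "orthogonal_transformation T" "T v = norm v *\<^sub>R e"
    using orthogonal_transformation_exists[of v "norm v *\<^sub>R e"] assms by auto
  have "(\<integral> z. \<bar>v \<bullet> z\<bar> powr r \<partial>uball) = (\<integral> z. \<bar>T v \<bullet> T z\<bar> powr r \<partial>uball)"
    using T(1) by (simp add: orthogonal_transformation_def)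
  also have "\<dots> = (\<integral> z. \<bar>T v \<bullet> z\<bar> powr r \<partial>uball)"
    by (rule integral_uball_orthogonal[OF T(1)]) simp
  also have "\<dots> = norm v powr r * (\<integral> z. \<bar>e \<bullet> z\<bar> powr r \<partial>uball)"
    by (simp add: T abs_mult powr_mult)
  finally show ?thesis
    using assms by (simp add: K_const_def ball_average_eq_uball powr_mult powr_powr)
qed

section \<open>Integrability and dominated convergence on the unit ball\<close>

lemma measure_uball_UNIV [simp]: "measure (uball :: 'a::euclidean_space measure) UNIV = 1"
proof -
  interpret prob_space "uball :: 'a measure" by (rule prob_space_uball)
  show ?thesis using prob_space by simp
qed

lemma AE_uball_norm_less_1: "AE z in uball. norm (z :: 'a::euclidean_space) < 1"
  by (rule AE_uniform_measureI) auto

lemma integrable_uball_bounded: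
  fixes g :: "'a::euclidean_space \<Rightarrow> real"
  assumes "g \<in> borel_measurable borel" "\<And>z. norm z < 1 \<Longrightarrow> \<bar>g z\<bar> \<le> B"
  shows "integrable uball g"
proof -
  interpret prob_space "uball :: 'a measure" by (rule prob_space_uball)
  show ?thesis
    using assms AE_uball_norm_less_1 by (intro integrable_const_bound[where B=B]) auto
qed

lemma abs_integral_uball_le:
  fixes g :: "'a::euclidean_space \<Rightarrow> real"
  assumes "g \<in> borel_measurable borel" "\<And>z. norm z < 1 \<Longrightarrow> \<bar>g z\<bar> \<le> B"
  shows "\<bar>\<integral> z. g z \<partial>uball\<bar> \<le> B"
proof -
  interpret prob_space "uball :: 'a measure" by (rule prob_space_uball)
  have "\<bar>\<integral> z. g z \<partial>uball\<bar> \<le> (\<integral> z. \<bar>g z\<bar> \<partial>uball)"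
    by (rule integral_abs_bound)
  also have "\<dots> \<le> (\<integral> z. B \<partial>(uball :: 'a measure))"
    using integrable_uball_bounded[OF assms] AE_uball_norm_less_1 assms(2)
    by (intro integral_mono_AE) auto
  finally show ?thesis by (simp add: prob_space)
qed

lemma integrable_uball_continuous:
  fixes g :: "'a::euclidean_space \<Rightarrow> real"
  assumes "continuous_on UNIV g"
  shows "integrable uball g"
proof -
  have "bounded (g ` cball 0 1)"
    using assms by (intro compact_imp_bounded compact_continuous_image continuous_on_subset[OF assms]) auto
  then obtain B where "\<forall>z\<in>cball 0 1. \<bar>g z\<bar> \<le> B" by (auto simp: bounded_iff)
  then show ?thesis
    using assms by (intro integrable_uball_bounded[of g B] borel_measurable_continuous_onI) auto
qed

text \<open>Dominated convergence along every sequence of positive radii tending to 0; on a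
  probability space the constant \<open>B\<close> is an integrable majorant.\<close>

lemma tendsto_integral_uball_at_right_0:
  fixes h :: "real \<Rightarrow> 'a::euclidean_space \<Rightarrow> real"
  assumes meas: "\<And>t. 0 < t \<Longrightarrow> h t \<in> borel_measurable borel" "h0 \<in> borel_measurable borel"
    and bound: "\<And>t z. 0 < t \<Longrightarrow> norm z < 1 \<Longrightarrow> \<bar>h t z\<bar> \<le> B"
    and lim: "\<And>z. norm z < 1 \<Longrightarrow> ((\<lambda>t. h t z) \<longlongrightarrow> h0 z) (at_right 0)"
  shows "((\<lambda>t. \<integral> z. h t z \<partial>uball) \<longlongrightarrow> (\<integral> z. h0 z \<partial>uball)) (at_right 0)"
  unfolding tendsto_at_iff_sequentially comp_def
proof (intro allI impI)
  fix X :: "nat \<Rightarrow> real" assume X: "\<forall>i. X i \<in> {0<..} - {0}" "X \<longlonglongrightarrow> 0"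
  interpret prob_space "uball :: 'a measure" by (rule prob_space_uball)
  show "(\<lambda>i. \<integral> z. h (X i) z \<partial>uball) \<longlonglongrightarrow> (\<integral> z. h0 z \<partial>uball)"
  proof (rule integral_dominated_convergence[where w="\<lambda>_. B"])
    show "AE z in uball. (\<lambda>i. h (X i) z) \<longlonglongrightarrow> h0 z"
      using AE_uball_norm_less_1
      by eventually_elim (use lim X in \<open>auto simp: tendsto_at_iff_sequentially comp_def\<close>)
    show "AE z in uball. norm (h (X i) z) \<le> B" for i
      using AE_uball_norm_less_1 by eventually_elim (use bound X in auto)
  qed (use meas X in auto)
qed

section \<open>Gradients of compactly supported C1 functions\<close>

text \<open>\<open>grad\<close> is a definite description: existence comes from representing the
  derivative as an inner product in the standard basis, uniqueness from that of the
  derivative.\<close>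

lemma C1_has_derivative:
  assumes "C1_compact_support f"
  shows "(f has_derivative (\<lambda>h. grad f x \<bullet> h)) (at x)"
proof -
  obtain f' where f': "(f has_derivative f') (at x)"
    using assms by (auto simp: C1_compact_support_def differentiable_def)
  interpret f': linear f' by (rule has_derivative_linear[OF f'])
  let ?D = "\<Sum>b\<in>Basis. f' b *\<^sub>R b"
  have "f' h = h \<bullet> ?D" for h
  proof -
    have "f' h = f' (\<Sum>b\<in>Basis. (h \<bullet> b) *\<^sub>R b)" by (simp add: euclidean_representation)
    then show ?thesis by (simp add: f'.sum f'.scaleR inner_sum_right mult.commute)
  qed
  then have "f' = (\<lambda>h. h \<bullet> ?D)" by (rule ext)
  with f' have D: "GDERIV f x :> ?D"
    by (simp only: gderiv_def)
  have "GDERIV f x :> grad f x"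
    unfolding grad_def
  proof (rule theI[of _ ?D])
    fix D' assume "GDERIV f x :> D'"
    then have "(\<lambda>h. h \<bullet> D') = (\<lambda>h. h \<bullet> ?D)"
      using D unfolding gderiv_def by (rule has_derivative_unique)
    then have "h \<bullet> D' = h \<bullet> ?D" for h by (rule fun_cong)
    then show "D' = ?D" by (rule vector_eq_ldot[THEN iffD1, rule_format])
  qed (rule D)
  then show ?thesis by (simp add: gderiv_def inner_commute)
qed

lemma C1_continuous:
  assumes "C1_compact_support f"
  shows "continuous_on UNIV f"
  using C1_has_derivative[OF assms] has_derivative_continuous
  by (intro continuous_at_imp_continuous_on) blast

text \<open>Continuity bounds the gradient on the compact support; on the open complement
  \<open>f\<close> vanishes, and with it the gradient.\<close>

lemma C1_grad_bounded:
  fixes f :: "'a::euclidean_space \<Rightarrow> real"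
  assumes "C1_compact_support f"
  obtains B where "0 \<le> B" "\<And>y. norm (grad f y) \<le> B"
proof -
  let ?K = "closure {x. f x \<noteq> 0}"
  have "bounded (grad f ` ?K)"
    using assms
    by (intro compact_imp_bounded compact_continuous_image)
       (auto simp: C1_compact_support_def intro: continuous_on_subset)
  then obtain B where B: "0 < B" "\<And>y. y \<in> ?K \<Longrightarrow> norm (grad f y) \<le> B"
    by (auto simp: bounded_pos)
  have "norm (grad f y) \<le> B" for y
  proof (cases "y \<in> ?K")
    case False
    have "((\<lambda>_. 0) has_derivative (\<lambda>h. grad f y \<bullet> h)) (at y)"
    proof (rule has_derivative_transform_within_open[OF C1_has_derivative[OF assms]])
      show "open (- ?K)" "y \<in> - ?K" using False by auto
      show "f z = 0" if "z \<in> - ?K" for z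
        using that closure_subset[of "{x. f x \<noteq> 0}"] by auto
    qed
    then have "(\<lambda>h. grad f y \<bullet> h) = (\<lambda>_. 0)"
      by (rule has_derivative_unique) (rule has_derivative_const)
    then have "grad f y = 0" by (metis inner_eq_zero_iff)
    with B show ?thesis by simp
  qed (use B in auto)
  with B(1) that show thesis by (meson less_imp_le)
qed

lemma C1_lipschitz:
  fixes f :: "'a::euclidean_space \<Rightarrow> real"
  assumes "C1_compact_support f" "\<And>y. norm (grad f y) \<le> B"
  shows "\<bar>f y - f x\<bar> \<le> B * norm (y - x)"
proof -
  have "onorm (\<lambda>h. grad f z \<bullet> h) \<le> B" for z
    by (rule onorm_le) (metis assms(2) Cauchy_Schwarz_ineq2 mult_right_mono norm_ge_zero order_trans real_norm_def)
  then have "norm (f y - f x) \<le> B * norm (y - x)"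
    using C1_has_derivative[OF assms(1)] by (intro differentiable_bound[of UNIV]) auto
  then show ?thesis by simp
qed

lemma C1_difference_quotient_tendsto:
  assumes "C1_compact_support f"
  shows "((\<lambda>t. (f (x + t *\<^sub>R z) - f x) / t) \<longlongrightarrow> grad f x \<bullet> z) (at_right 0)"
proof -
  have "((\<lambda>t. f (x + t *\<^sub>R z)) has_derivative (\<lambda>t. grad f x \<bullet> (t *\<^sub>R z))) (at 0)"
    using C1_has_derivative[OF assms, of x]
    by (intro has_derivative_compose[of "\<lambda>t. x + t *\<^sub>R z" "\<lambda>t. t *\<^sub>R z" 0 UNIV f "\<lambda>h. grad f x \<bullet> h"])
       (auto intro!: derivative_eq_intros)
  then have "((\<lambda>t. f (x + t *\<^sub>R z)) has_field_derivative (grad f x \<bullet> z)) (at 0)"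
    by (simp add: has_field_derivative_def mult.commute[of _ "grad f x \<bullet> z"] mult_commute_abs)
  then have "((\<lambda>t. (f (x + t *\<^sub>R z) - f x) / t) \<longlongrightarrow> grad f x \<bullet> z) (at 0)"
    by (simp add: DERIV_def)
  then show ?thesis by (rule tendsto_within_subset) auto
qed

section \<open>The oscillation at small scales\<close>

text \<open>The oscillation does not see an additive constant and is positively homogeneous, so
  subtracting \<open>f x\<close> and dividing by \<open>t\<close> turns \<open>f\<close> into its
  difference quotient.\<close>

lemma mean_osc_div_eq:
  fixes f :: "'a::euclidean_space \<Rightarrow> real" and x :: 'a
  assumes "continuous_on UNIV f" "0 < t" "0 < r"
  defines "\<phi> \<equiv> \<lambda>z. (f (x + t *\<^sub>R z) - f x) / t"
  shows "mean_osc r f x t / t = (\<integral> z. \<bar>\<phi> z - (\<integral> w. \<phi> w \<partial>uball)\<bar> powr r \<partial>uball) powr (1 / r)"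
proof -
  interpret prob_space "uball :: 'a measure" by (rule prob_space_uball)
  have [measurable]: "f \<in> borel_measurable borel"
    by (rule borel_measurable_continuous_onI[OF assms(1)])
  have int: "integrable uball (\<lambda>z. f (x + t *\<^sub>R z))"
    by (intro integrable_uball_continuous continuous_on_compose2[OF assms(1)]) (intro continuous_intros, simp)
  have avg: "(\<integral> w. \<phi> w \<partial>uball) = ((\<integral> w. f (x + t *\<^sub>R w) \<partial>uball) - f x) / t"
    unfolding \<phi>_def using int by simp
  have "\<bar>\<phi> z - (\<integral> w. \<phi> w \<partial>uball)\<bar> powr r =
      \<bar>f (x + t *\<^sub>R z) - (\<integral> w. f (x + t *\<^sub>R w) \<partial>uball)\<bar> powr r / t powr r" for z
    unfolding avg using \<open>0 < t\<close>
    by (simp add: \<phi>_def powr_divide[symmetric] diff_divide_distrib[symmetric])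
  then have "(\<integral> z. \<bar>\<phi> z - (\<integral> w. \<phi> w \<partial>uball)\<bar> powr r \<partial>uball) =
      (\<integral> z. \<bar>f (x + t *\<^sub>R z) - (\<integral> w. f (x + t *\<^sub>R w) \<partial>uball)\<bar> powr r \<partial>uball) / t powr r"
    by simp
  then show ?thesis
    using assms(2,3) by (simp add: mean_osc_eq_uball powr_divide powr_powr)
qed

text \<open>Dominated convergence is used twice: first for the average of the difference quotients,
  whose limit is the average 0 of a linear function, then for the r-th power of the deviation from
  it.\<close>

lemma mean_osc_div_tendsto:
  fixes f :: "'a::euclidean_space \<Rightarrow> real"
  assumes f: "C1_compact_support f" and r: "0 < r"
  shows "((\<lambda>t. mean_osc r f x t / t) \<longlongrightarrow>
    (\<integral> z. \<bar>grad f x \<bullet> z\<bar> powr r \<partial>uball) powr (1 / r)) (at_right 0)"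
proof -
  obtain B where B: "0 \<le> B" "\<And>y. norm (grad f y) \<le> B" using C1_grad_bounded[OF f] by blast
  note cont = C1_continuous[OF f]
  have [measurable]: "f \<in> borel_measurable borel"
    by (rule borel_measurable_continuous_onI[OF cont])
  define \<phi> where "\<phi> = (\<lambda>t z. (f (x + t *\<^sub>R z) - f x) / t)"
  have [measurable]: "\<phi> t \<in> borel_measurable borel" for t
    unfolding \<phi>_def by measurable
  have \<phi>_le: "\<bar>\<phi> t z\<bar> \<le> B" if "0 < t" "norm z < 1" for t z
  proof -
    have "\<bar>f (x + t *\<^sub>R z) - f x\<bar> \<le> B * (t * norm z)"
      using C1_lipschitz[OF f B(2), of "x + t *\<^sub>R z" x] that by simp
    also have "\<dots> \<le> B * (t * 1)"
      using that B(1) by (intro mult_left_mono) auto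
    finally show ?thesis using that by (simp add: \<phi>_def abs_div field_simps)
  qed
  have \<phi>_lim: "((\<lambda>t. \<phi> t z) \<longlongrightarrow> grad f x \<bullet> z) (at_right 0)" for z
    unfolding \<phi>_def by (rule C1_difference_quotient_tendsto[OF f])
  have avg_lim: "((\<lambda>t. \<integral> w. \<phi> t w \<partial>uball) \<longlongrightarrow> 0) (at_right 0)"
    using tendsto_integral_uball_at_right_0[of \<phi> "\<lambda>z. grad f x \<bullet> z" B] \<phi>_le \<phi>_lim
    by (simp add: integral_uball_inner_eq_0)
  have "((\<lambda>t. \<integral> z. \<bar>\<phi> t z - (\<integral> w. \<phi> t w \<partial>uball)\<bar> powr r \<partial>uball) \<longlongrightarrow>
      (\<integral> z. \<bar>grad f x \<bullet> z\<bar> powr r \<partial>uball)) (at_right 0)"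
  \<comment> \<open>The quotient and its average are both at most \<open>B\<close> in absolute
    value.\<close>
  proof (rule tendsto_integral_uball_at_right_0[where B="(2 * B) powr r"])
    show "\<bar>\<bar>\<phi> t z - (\<integral> w. \<phi> t w \<partial>uball)\<bar> powr r\<bar> \<le> (2 * B) powr r" if "0 < t" "norm z < 1" for t z
      using \<phi>_le[OF that] abs_integral_uball_le[of "\<phi> t" B] \<phi>_le[OF that(1)] r
      by (auto intro!: powr_mono2)
    show "((\<lambda>t. \<bar>\<phi> t z - (\<integral> w. \<phi> t w \<partial>uball)\<bar> powr r) \<longlongrightarrow> \<bar>grad f x \<bullet> z\<bar> powr r) (at_right 0)" for z
      using tendsto_rabs[OF tendsto_diff[OF \<phi>_lim[of z] avg_lim]] r by (intro tendsto_powr') auto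
  qed auto
  then have "((\<lambda>t. (\<integral> z. \<bar>\<phi> t z - (\<integral> w. \<phi> t w \<partial>uball)\<bar> powr r \<partial>uball) powr (1 / r)) \<longlongrightarrow>
      (\<integral> z. \<bar>grad f x \<bullet> z\<bar> powr r \<partial>uball) powr (1 / r)) (at_right 0)"
    using r by (intro tendsto_powr') auto
  then show ?thesis
    by (rule Lim_transform_eventually)
       (auto simp: \<phi>_def mean_osc_div_eq[OF cont _ r] eventually_at_right_less intro!: eventually_at_rightI[of 0 1])
qed

section \<open>Convexity of the r-th power\<close>

text \<open>A convex function lies above its tangent at \<open>c\<close>. The tangent rule is
  applied on the open half-line, which leaves \<open>a = 0\<close> to be checked by hand.\<close>

lemma powr_ge_tangent:
  fixes a c r :: real
  assumes "1 \<le> r" "0 \<le> a" "0 < c"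
  shows "c powr r + r * c powr (r - 1) * (a - c) \<le> a powr r"
proof (cases "a = 0")
  case True
  have "c powr r = c powr (r - 1) * c"
    using assms by (simp add: powr_diff)
  with True assms show ?thesis
    by (simp add: algebra_simps mult_right_mono)
next
  case False
  have "r * c powr (r - 1) * (a - c) \<le> a powr r - c powr r"
  proof (rule convex_on_imp_above_tangent[OF powr_convex[OF assms(1)]])
    show "((\<lambda>x. x powr r) has_field_derivative r * c powr (r - 1)) (at c within {0<..})"
      using assms by (auto intro!: derivative_eq_intros)
  qed (use assms False in \<open>auto simp: interior_open\<close>)
  then show ?thesis by simp
qed

text \<open>The tangent inequalities at the midpoint are added; their linear terms cancel. The
  factor \<open>2 powr (r - 1)\<close> leads to the final constant 2.\<close>

lemma powr_add_le:
  fixes a b r :: real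
  assumes "1 \<le> r" "0 \<le> a" "0 \<le> b"
  shows "(a + b) powr r \<le> 2 powr (r - 1) * (a powr r + b powr r)"
proof (cases "a + b = 0")
  case False
  define c where "c = (a + b) / 2"
  have c: "0 < c" "a + b = 2 * c" using False assms by (auto simp: c_def)
  have "2 * c powr r \<le> a powr r + b powr r"
  proof -
    have "r * c powr (r - 1) * (a - c) + r * c powr (r - 1) * (b - c) = 0"
      using c(2) by (simp add: distrib_left[symmetric])
    then show ?thesis
      using powr_ge_tangent[OF assms(1,2) c(1)] powr_ge_tangent[OF assms(1,3) c(1)] by linarith
  qed
  then have "2 powr (r - 1) * (2 * c powr r) \<le> 2 powr (r - 1) * (a powr r + b powr r)"
    by (rule mult_left_mono) simp
  then show ?thesis
    using c by (simp add: powr_mult powr_diff)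
qed simp

text \<open>Jensen's inequality: the tangent at the mean has as its expectation the power of the
  mean.\<close>

lemma (in prob_space) powr_expectation_le:
  fixes u :: "'a \<Rightarrow> real"
  assumes "1 \<le> r" "integrable M u" "integrable M (\<lambda>x. u x powr r)" "\<And>x. 0 \<le> u x"
  shows "expectation u powr r \<le> expectation (\<lambda>x. u x powr r)"
proof (cases "expectation u = 0")
  case False
  define c where "c = expectation u"
  have c: "0 < c" using False assms(4) by (simp add: c_def less_le)
  have "expectation (\<lambda>x. c powr r + r * c powr (r - 1) * (u x - c)) \<le> expectation (\<lambda>x. u x powr r)"
    using assms c by (intro integral_mono) (auto intro!: powr_ge_tangent)
  also have "expectation (\<lambda>x. c powr r + r * c powr (r - 1) * (u x - c)) = c powr r"
    using assms by (simp add: prob_space c_def)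
  finally show ?thesis by (simp add: c_def)
qed simp

text \<open>Jensen's inequality again, for the gauge integral in which the fundamental theorem of
  calculus is stated.\<close>

lemma powr_integral_0_1_le:
  fixes u :: "real \<Rightarrow> real"
  assumes "1 \<le> r" "continuous_on {0..1} u" "\<And>s. 0 \<le> u s"
  shows "integral {0..1} u powr r \<le> integral {0..1} (\<lambda>s. u s powr r)"
proof (cases "integral {0..1} u = 0")
  case False
  define c where "c = integral {0..1} u"
  have int: "u integrable_on {0..1}" "(\<lambda>s. u s powr r) integrable_on {0..1}"
    using assms by (auto intro!: integrable_continuous_real continuous_on_powr')
  have c: "0 < c"
    using False assms(3) int(1) by (auto simp: c_def less_le intro!: integral_nonneg)
  have "((\<lambda>s. c powr r + r * c powr (r - 1) * (u s - c)) has_integral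
      (1 * c powr r + r * c powr (r - 1) * (c - 1 * c))) {0..1}"
    using int(1) unfolding c_def
    by (intro has_integral_add has_integral_mult_right has_integral_diff integrable_integral)
       (use has_integral_const_real[of _ 0 1] in auto)
  then have "c powr r \<le> integral {0..1} (\<lambda>s. u s powr r)"
    using int(2) assms c
    by (intro has_integral_le[OF _ integrable_integral]) (auto intro!: powr_ge_tangent)
  then show ?thesis by (simp add: c_def)
qed (use assms in \<open>auto intro!: integral_nonneg integrable_continuous_real continuous_on_powr'\<close>)

section \<open>Control of the oscillation by the maximal function\<close>

text \<open>The fundamental theorem of calculus along the segment from \<open>x\<close> to
  \<open>x + w\<close>, then Cauchy-Schwarz, then Jensen in the segment parameter.\<close>

lemma C1_diff_powr_le:
  fixes f :: "'a::euclidean_space \<Rightarrow> real"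
  assumes f: "C1_compact_support f" and r: "1 \<le> r"
  shows "\<bar>f (x + w) - f x\<bar> powr r \<le> norm w powr r * integral {0..1} (\<lambda>s. norm (grad f (x + s *\<^sub>R w)) powr r)"
proof -
  define p where "p = (\<lambda>s::real. norm (grad f (x + s *\<^sub>R w)))"
  have cg: "continuous_on UNIV (grad f)" using f by (simp add: C1_compact_support_def)
  have cgl: "continuous_on S (\<lambda>s. grad f (x + s *\<^sub>R w))" for S :: "real set"
    by (rule continuous_on_compose2[OF cg]) (intro continuous_intros, simp)
  have ftc: "((\<lambda>s. grad f (x + s *\<^sub>R w) \<bullet> w) has_integral (f (x + 1 *\<^sub>R w) - f (x + 0 *\<^sub>R w))) {0..1}"
  proof (rule fundamental_theorem_of_calculus)
    fix s :: real
    have "((\<lambda>s. f (x + s *\<^sub>R w)) has_derivative (\<lambda>h. grad f (x + s *\<^sub>R w) \<bullet> (h *\<^sub>R w))) (at s within {0..1})"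
      using C1_has_derivative[OF f, of "x + s *\<^sub>R w"]
      by (intro has_derivative_compose[of "\<lambda>s. x + s *\<^sub>R w" "\<lambda>h. h *\<^sub>R w" s _ f "\<lambda>h. grad f (x + s *\<^sub>R w) \<bullet> h"])
         (auto intro!: derivative_eq_intros)
    then show "((\<lambda>s. f (x + s *\<^sub>R w)) has_vector_derivative grad f (x + s *\<^sub>R w) \<bullet> w) (at s within {0..1})"
      by (simp add: has_vector_derivative_def)
  qed simp
  have "norm (integral {0..1} (\<lambda>s. grad f (x + s *\<^sub>R w) \<bullet> w)) \<le> integral {0..1} (\<lambda>s. norm w * p s)"
    unfolding p_def using cgl
    by (intro integral_norm_bound_integral integrable_continuous_real continuous_intros)
       (auto simp: mult.commute[of "norm w"] Cauchy_Schwarz_ineq2)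
  also have "integral {0..1} (\<lambda>s. grad f (x + s *\<^sub>R w) \<bullet> w) = f (x + w) - f x"
    using integral_unique[OF ftc] by simp
  finally have "\<bar>f (x + w) - f x\<bar> powr r \<le> (norm w * integral {0..1} p) powr r"
    using r by (intro powr_mono2) auto
  also have "\<dots> = norm w powr r * integral {0..1} p powr r"
    by (intro powr_mult) 
  also have "\<dots> \<le> norm w powr r * integral {0..1} (\<lambda>s. p s powr r)"
    using powr_integral_0_1_le[OF r, of p] continuous_on_norm[OF cgl] unfolding p_def
    by (intro mult_left_mono) auto
  finally show ?thesis unfolding p_def .
qed

lemma nn_average_le_HL_maximal:
  fixes x :: "'a::euclidean_space" and g :: "'a \<Rightarrow> real"
  assumes "0 < t" and "g \<in> borel_measurable borel"
  shows "(\<integral>\<^sup>+ z. ennreal \<bar>g (x + t *\<^sub>R z)\<bar> \<partial>uball) \<le> HL_maximal g x"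
proof -
  have "(\<integral>\<^sup>+ y\<in>ball x t. ennreal \<bar>g y\<bar> \<partial>lborel) / emeasure lborel (ball x t) \<le> HL_maximal g x"
    unfolding HL_maximal_def using assms(1) by (intro SUP_upper) auto
  then show ?thesis
    using assms by (subst (asm) nn_average_ball_eq_uball) auto
qed

text \<open>Tonelli's theorem exchanges the segment parameter \<open>s\<close> and the point
  \<open>z\<close>. For fixed \<open>s\<close> the integral over \<open>z\<close> is an average over
  the ball of radius \<open>s * t\<close>, which the maximal function bounds.\<close>

lemma nn_integral_diff_powr_le:
  fixes f :: "'a::euclidean_space \<Rightarrow> real"
  assumes f: "C1_compact_support f" and r: "1 \<le> r" and t: "0 < t"
  shows "(\<integral>\<^sup>+ z. ennreal (\<bar>f (x + t *\<^sub>R z) - f x\<bar> powr r) \<partial>uball) \<le>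
    ennreal (t powr r) * HL_maximal (\<lambda>y. norm (grad f y) powr r) x"
proof -
  let ?M = "HL_maximal (\<lambda>y. norm (grad f y) powr r) x"
  let ?G = "\<lambda>z s. ennreal (norm (grad f (x + (s * t) *\<^sub>R z)) powr r)"
  interpret prob_space "uball :: 'a measure" by (rule prob_space_uball)
  interpret pair_sigma_finite "uball :: 'a measure" "lborel :: real measure" ..
  have cg: "continuous_on UNIV (grad f)" using f by (simp add: C1_compact_support_def)
  have [measurable]: "f \<in> borel_measurable borel" "grad f \<in> borel_measurable borel"
    using C1_continuous[OF f] cg by (auto intro: borel_measurable_continuous_onI)
  have "(\<integral>\<^sup>+ z. ennreal (\<bar>f (x + t *\<^sub>R z) - f x\<bar> powr r) \<partial>uball) \<le>
      (\<integral>\<^sup>+ z. (\<integral>\<^sup>+ s. ennreal (t powr r) * (indicator {0..1} s * ?G z s) \<partial>lborel) \<partial>uball)"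
  proof (rule nn_integral_mono_AE)
    have "ennreal (\<bar>f (x + t *\<^sub>R z) - f x\<bar> powr r) \<le> (\<integral>\<^sup>+ s. ennreal (t powr r) * (indicator {0..1} s * ?G z s) \<partial>lborel)"
      if "norm z < 1" for z
    proof -
      let ?p = "\<lambda>s. norm (grad f (x + s *\<^sub>R t *\<^sub>R z)) powr r"
      have cp: "continuous_on {0..1} ?p"
        using r by (intro continuous_on_powr' continuous_on_norm continuous_on_compose2[OF cg] continuous_intros) auto
      have I: "(?p has_integral integral {0..1} ?p) {0..1}"
        by (intro integrable_integral integrable_continuous_real cp)
      have "\<bar>f (x + t *\<^sub>R z) - f x\<bar> powr r \<le> norm (t *\<^sub>R z) powr r * integral {0..1} ?p"
        by (rule C1_diff_powr_le[OF f r])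
      also have "\<dots> \<le> t powr r * integral {0..1} ?p"
        using that t r has_integral_nonneg[OF I]
        by (intro mult_right_mono powr_mono2) (auto simp: mult_le_cancel_left1)
      finally have "ennreal (\<bar>f (x + t *\<^sub>R z) - f x\<bar> powr r) \<le> ennreal (t powr r) * ennreal (integral {0..1} ?p)"
        by (simp add: ennreal_mult'[symmetric] ennreal_leI)
      \<comment> \<open>The gauge integral becomes a Lebesgue integral, to which Tonelli's theorem
        applies.\<close>
      also have "ennreal (integral {0..1} ?p) = (\<integral>\<^sup>+ s. ennreal (indicator {0..1} s * ?p s) \<partial>lborel)"
        using nn_integral_has_integral_lebesgue[OF _ I] by simp
      also have "\<dots> = (\<integral>\<^sup>+ s. indicator {0..1} s * ?G z s \<partial>lborel)"
        by (intro nn_integral_cong) (simp add: indicator_def)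
      also have "ennreal (t powr r) * \<dots> = (\<integral>\<^sup>+ s. ennreal (t powr r) * (indicator {0..1} s * ?G z s) \<partial>lborel)"
        by (intro nn_integral_cmult[symmetric]) simp
      finally show ?thesis .
    qed
    then show "AE z in uball. ennreal (\<bar>f (x + t *\<^sub>R z) - f x\<bar> powr r)
        \<le> (\<integral>\<^sup>+ s. ennreal (t powr r) * (indicator {0..1} s * ?G z s) \<partial>lborel)"
      by (rule eventually_mono[OF AE_uball_norm_less_1])
  qed
  also have "\<dots> = (\<integral>\<^sup>+ s. (\<integral>\<^sup>+ z. ennreal (t powr r) * (indicator {0..1} s * ?G z s) \<partial>uball) \<partial>lborel)"
    by (rule Fubini'[symmetric]) measurable
  also have "\<dots> \<le> (\<integral>\<^sup>+ s. ennreal (t powr r) * (indicator {0..1} s * ?M) \<partial>(lborel :: real measure))"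
  proof (rule nn_integral_mono_AE)
    \<comment> \<open>The value \<open>s = 0\<close> is set aside as a null set: the supremum in
      \<open>HL_maximal\<close> runs over positive radii.\<close>
    have "(\<integral>\<^sup>+ z. ennreal (t powr r) * (indicator {0..1} s * ?G z s) \<partial>uball) \<le> ennreal (t powr r) * (indicator {0..1} s * ?M)"
      if "s \<noteq> 0" for s :: real
    proof (cases "s \<in> {0..1}")
      case True
      with that t have "(\<integral>\<^sup>+ z. ?G z s \<partial>uball) \<le> ?M"
        using nn_average_le_HL_maximal[of "s * t" "\<lambda>y. norm (grad f y) powr r" x] by simp
      then show ?thesis
        using True by (subst nn_integral_cmult) (auto intro!: mult_left_mono)
    qed simp
    then show "AE s in lborel. (\<integral>\<^sup>+ z. ennreal (t powr r) * (indicator {0..1} s * ?G z s) \<partial>uball) \<le> ennreal (t powr r) * (indicator {0..1} s * ?M)"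
      by (rule eventually_mono[OF AE_lborel_singleton[of 0]])
  qed
  also have "\<dots> = ennreal (t powr r) * ?M"
    by (subst nn_integral_cmult, simp, subst nn_integral_multc) simp_all
  finally show ?thesis .
qed

text \<open>Let \<open>c\<close> be the mean and \<open>I\<close> the r-th absolute moment of the
  difference quotient. Jensen gives \<open>\<bar>c\<bar> powr r \<le> I\<close>, so the centred
  moment is at most \<open>2 powr r * I\<close>, and the root leaves the factor 2.\<close>

lemma mean_osc_div_le:
  fixes f :: "'a::euclidean_space \<Rightarrow> real"
  assumes f: "C1_compact_support f" and r: "1 \<le> r" and t: "0 < t"
    and M: "HL_maximal (\<lambda>y. norm (grad f y) powr r) x = ennreal m" "0 \<le> m"
  shows "mean_osc r f x t / t \<le> 2 * m powr (1 / r)"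
proof -
  interpret prob_space "uball :: 'a measure" by (rule prob_space_uball)
  define \<phi> where "\<phi> = (\<lambda>z. (f (x + t *\<^sub>R z) - f x) / t)"
  have cf: "continuous_on UNIV f" by (rule C1_continuous[OF f])
  have [measurable]: "f \<in> borel_measurable borel"
    by (rule borel_measurable_continuous_onI[OF cf])
  have cphi: "continuous_on UNIV \<phi>"
    unfolding \<phi>_def using t by (intro continuous_intros continuous_on_compose2[OF cf]) auto
  have [measurable]: "\<phi> \<in> borel_measurable borel"
    by (rule borel_measurable_continuous_onI[OF cphi])
  define c where "c = (\<integral> w. \<phi> w \<partial>uball)"
  define I where "I = (\<integral> z. \<bar>\<phi> z\<bar> powr r \<partial>uball)"
  have int: "integrable uball (\<lambda>z. \<bar>\<phi> z\<bar> powr r)" "integrable uball (\<lambda>z. \<bar>\<phi> z\<bar>)" "integrable uball (\<lambda>z. \<bar>\<phi> z - c\<bar> powr r)"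
    using r cphi by (intro integrable_uball_continuous continuous_on_powr' continuous_intros; auto)+
  have "\<bar>c\<bar> powr r \<le> (\<integral> z. \<bar>\<phi> z\<bar> \<partial>uball) powr r"
    using r unfolding c_def by (intro powr_mono2 integral_abs_bound) auto
  also have "\<dots> \<le> I"
    unfolding I_def using r int by (intro powr_expectation_le) auto
  finally have c: "\<bar>c\<bar> powr r \<le> I" .
  have "(\<integral> z. \<bar>\<phi> z - c\<bar> powr r \<partial>uball) \<le> (\<integral> z. 2 powr (r - 1) * (\<bar>\<phi> z\<bar> powr r + \<bar>c\<bar> powr r) \<partial>uball)"
  proof (intro integral_mono int integrable_mult_right Bochner_Integration.integrable_add integrable_const)
    fix z
    have "\<bar>\<phi> z - c\<bar> powr r \<le> (\<bar>\<phi> z\<bar> + \<bar>c\<bar>) powr r"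
      using r by (intro powr_mono2) auto
    also have "\<dots> \<le> 2 powr (r - 1) * (\<bar>\<phi> z\<bar> powr r + \<bar>c\<bar> powr r)"
      using r by (intro powr_add_le) auto
    finally show "\<bar>\<phi> z - c\<bar> powr r \<le> 2 powr (r - 1) * (\<bar>\<phi> z\<bar> powr r + \<bar>c\<bar> powr r)" .
  qed
  also have "\<dots> = 2 powr (r - 1) * (I + \<bar>c\<bar> powr r)"
    using int by (simp add: I_def)
  also have "\<dots> \<le> 2 powr (r - 1) * (I + I)"
    using c by (intro mult_left_mono) auto
  also have "\<dots> = 2 powr r * I"
    by (simp add: powr_diff)
  finally have osc: "(\<integral> z. \<bar>\<phi> z - c\<bar> powr r \<partial>uball) \<le> 2 powr r * I" .
  \<comment> \<open>The moment is compared with the maximal function in \<open>ennreal\<close>; as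
    \<open>m\<close> is finite, the inequality can be read back in the reals.\<close>
  have "ennreal I = (\<integral>\<^sup>+ z. ennreal (\<bar>\<phi> z\<bar> powr r) \<partial>uball)"
    unfolding I_def using int(1) by (intro nn_integral_eq_integral[symmetric]) auto
  also have "\<dots> = (\<integral>\<^sup>+ z. ennreal (1 / t powr r) * ennreal (\<bar>f (x + t *\<^sub>R z) - f x\<bar> powr r) \<partial>uball)"
    using t by (intro nn_integral_cong) (simp add: \<phi>_def abs_div powr_divide ennreal_mult'[symmetric])
  also have "\<dots> = ennreal (1 / t powr r) * (\<integral>\<^sup>+ z. ennreal (\<bar>f (x + t *\<^sub>R z) - f x\<bar> powr r) \<partial>uball)"
    by (intro nn_integral_cmult) simp
  also have "\<dots> \<le> ennreal (1 / t powr r) * (ennreal (t powr r) * ennreal m)"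
    using nn_integral_diff_powr_le[OF f r t, of x] unfolding M(1) by (intro mult_left_mono) auto
  also have "\<dots> = ennreal m"
    using t M(2) by (simp add: ennreal_mult'[symmetric])
  finally have "I \<le> m" using M(2) by simp
  then have "(\<integral> z. \<bar>\<phi> z - c\<bar> powr r \<partial>uball) \<le> 2 powr r * m"
    by (intro order_trans[OF osc] mult_left_mono) simp_all
  then have "(\<integral> z. \<bar>\<phi> z - c\<bar> powr r \<partial>uball) powr (1 / r) \<le> (2 powr r * m) powr (1 / r)"
    using r by (intro powr_mono2) auto
  then show ?thesis
    using r t M(2) by (simp add: mean_osc_div_eq[OF cf] \<phi>_def c_def powr_mult powr_powr)
qed

text \<open>A bound on the gradient bounds all averages of its power. Finiteness lets the later
  estimates be carried out with real numbers.\<close>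

lemma HL_maximal_grad_finite:
  fixes f :: "'a::euclidean_space \<Rightarrow> real"
  assumes f: "C1_compact_support f" and r: "0 \<le> r"
  shows "HL_maximal (\<lambda>y. norm (grad f y) powr r) x < \<infinity>"
proof -
  interpret prob_space "uball :: 'a measure" by (rule prob_space_uball)
  obtain B where B: "0 \<le> B" "\<And>y. norm (grad f y) \<le> B" by (rule C1_grad_bounded[OF f], rule that)
  have [measurable]: "grad f \<in> borel_measurable borel"
    using f by (auto simp: C1_compact_support_def intro: borel_measurable_continuous_onI)
  have "(\<integral>\<^sup>+ y\<in>ball x t. ennreal \<bar>norm (grad f y) powr r\<bar> \<partial>lborel) / emeasure lborel (ball x t) \<le> ennreal (B powr r)"
    if "0 < t" for t
  proof -
    have "(\<integral>\<^sup>+ y\<in>ball x t. ennreal \<bar>norm (grad f y) powr r\<bar> \<partial>lborel) / emeasure lborel (ball x t)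
       = (\<integral>\<^sup>+ z. ennreal \<bar>norm (grad f (x + t *\<^sub>R z)) powr r\<bar> \<partial>uball)"
      using that by (intro nn_average_ball_eq_uball) auto
    also have "\<dots> \<le> (\<integral>\<^sup>+ z. ennreal (B powr r) \<partial>(uball :: 'a measure))"
      using B r by (intro nn_integral_mono ennreal_leI) (auto intro!: powr_mono2)
    also have "\<dots> = ennreal (B powr r)"
      using emeasure_space_1 by simp
    finally show ?thesis .
  qed
  then have "HL_maximal (\<lambda>y. norm (grad f y) powr r) x \<le> ennreal (B powr r)"
    unfolding HL_maximal_def by (intro SUP_least) auto
  then show ?thesis by (simp add: order_le_less_trans)
qed

section \<open>Mass of the level sets in the radius\<close>

lemma radial_mass_mono: "S \<subseteq> T \<Longrightarrow> radial_mass x \<gamma> S \<le> radial_mass x \<gamma> T"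
  unfolding radial_mass_def by (intro nn_integral_mono mult_left_mono) (auto simp: indicator_def)

text \<open>Unlike monotonicity, this rests on additivity of the integral and so on measurable
  sets.\<close>

lemma radial_mass_Un_le:
  assumes [measurable]: "S \<in> sets borel" "T \<in> sets borel"
  shows "radial_mass x \<gamma> (S \<union> T) \<le> radial_mass x \<gamma> S + radial_mass x \<gamma> T"
  unfolding radial_mass_def
  by (subst nn_integral_add[symmetric]) (auto intro!: nn_integral_mono simp: indicator_def)

text \<open>The region is \<open>(0, b)\<close> for \<open>\<gamma> > 0\<close> and \<open>(b, \<infinity>)\<close> for \<open>\<gamma> < 0\<close>, where \<open>b powr (\<gamma> / q) = c\<close>; this gives
  both cases of the theorem the same formula.\<close>
lemma has_integral_powr_region:
  fixes \<gamma> q c :: real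
  assumes "\<gamma> \<noteq> 0" "0 < q" "0 \<le> c"
  shows "((\<lambda>t. t powr (\<gamma> - 1)) has_integral (c powr q / \<bar>\<gamma>\<bar>)) {t. 0 < t \<and> t powr (\<gamma> / q) < c}"
proof (cases "c = 0")
  case True
  \<comment> \<open>Powers are nonnegative, so the region is empty, in accordance with
    \<open>0 powr q = 0\<close>.\<close>
  moreover have "{t. 0 < t \<and> t powr (\<gamma> / q) < 0} = {}" by (auto simp: not_less)
  ultimately show ?thesis by simp
next
  case False
  with assms have c: "0 < c" by simp
  define b where "b = c powr (q / \<gamma>)"
  have b: "0 < b" "b powr \<gamma> = c powr q" "b powr (\<gamma> / q) = c"
    using c assms by (auto simp: b_def powr_powr)
  show ?thesis
  proof (cases "0 < \<gamma>")
    case True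
    have "t powr (\<gamma> / q) < c \<longleftrightarrow> t < b" if "0 < t" for t
      using that b True assms powr_less_mono2[of "\<gamma> / q" t b] powr_mono2[of "\<gamma> / q" b t]
      by (cases "t < b") auto
    then have "{t. 0 < t \<and> t powr (\<gamma> / q) < c} = {0<..<b}" by auto
    moreover have "((\<lambda>t. t powr (\<gamma> - 1)) has_integral (b powr \<gamma> / \<gamma>)) {0..b}"
      using has_integral_powr_from_0[of "\<gamma> - 1" b] True b by simp
    ultimately show ?thesis
      using True b by (simp add: has_integral_Icc_iff_Ioo)
  next
    case False
    with assms have neg: "\<gamma> < 0" by simp
    then have e: "\<gamma> / q < 0" using assms by (simp add: divide_neg_pos)
    have "t powr (\<gamma> / q) < c \<longleftrightarrow> b < t" if "0 < t" for t
      using that b e powr_less_mono2_neg[of "\<gamma> / q" b t] powr_mono2'[of "\<gamma> / q" t b]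
      by (cases "b < t") auto
    then have eq: "{t. 0 < t \<and> t powr (\<gamma> / q) < c} = {b<..}" using b(1) by auto
    have "((\<lambda>t. t powr (\<gamma> - 1)) has_integral (b powr \<gamma> / (- \<gamma>))) {b..}"
      using has_integral_powr_to_inf[of "\<gamma> - 1" b] neg b by simp
    then have "((\<lambda>t. t powr (\<gamma> - 1)) has_integral (b powr \<gamma> / (- \<gamma>))) {b<..}"
      by (subst has_integral_spike_set_eq[of _ "{b..}"]) (auto intro: negligible_subset[of "{b}"])
    then show ?thesis
      using neg b unfolding eq by simp
  qed
qed

text \<open>With \<open>c / lam\<close> in place of \<open>c\<close> the value is proportional to
  \<open>lam powr (- q)\<close>, which exactly compensates the factor \<open>lam\<close> in the
  functional.\<close>

lemma radial_mass_region:
  fixes x :: "'a::euclidean_space"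
  assumes "\<gamma> \<noteq> 0" "0 < q" "0 \<le> c"
  shows "radial_mass x \<gamma> {t. 0 < t \<and> t powr (\<gamma> / q) < c} =
    ennreal (sphere_measure (sphere (0::'a) 1) / \<bar>\<gamma>\<bar> * c powr q)"
  by (subst radial_mass_has_integral[OF _ _ has_integral_powr_region[OF assms]]) auto

lemma sphere_measure_unit_sphere_nonneg: "0 \<le> sphere_measure (sphere (0 :: 'a::euclidean_space) 1)"
  by (simp add: sphere_measure_unit_sphere)

text \<open>The radii of the points of \<open>E_set\<close>, once \<open>g t\<close> is taken to be
  \<open>mean_osc r f x t / t\<close>; one factor \<open>t\<close> of the defining inequality has
  been divided out.\<close>

definition radii_above :: "(real \<Rightarrow> real) \<Rightarrow> real \<Rightarrow> real \<Rightarrow> real \<Rightarrow> real set" where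
  "radii_above g lam q \<gamma> = {t. 0 < t \<and> lam * t powr (\<gamma> / q) < g t}"

lemma radii_above_subset:
  assumes "0 < lam" "\<And>t. 0 < t \<Longrightarrow> g t \<le> G"
  shows "radii_above g lam q \<gamma> \<subseteq> {t. 0 < t \<and> t powr (\<gamma> / q) < G / lam}"
  using assms by (force simp: radii_above_def field_simps)

lemma radial_mass_radii_above_le:
  fixes x :: "'a::euclidean_space"
  assumes "\<gamma> \<noteq> 0" "0 < q" "0 < lam" "0 \<le> G" "\<And>t. 0 < t \<Longrightarrow> g t \<le> G"
  shows "radial_mass x \<gamma> (radii_above g lam q \<gamma>) \<le>
    ennreal (sphere_measure (sphere (0::'a) 1) / \<bar>\<gamma>\<bar> * (G / lam) powr q)"
  using radial_mass_mono[OF radii_above_subset[of lam g G q \<gamma>], of x \<gamma>] radial_mass_region[of \<gamma> q "G / lam" x] assms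
  by simp

text \<open>Membership in the level set depends on the distance alone, and \<open>lam\<close> moves
  inside the root as \<open>lam powr q\<close>. What remains to be studied is
  \<open>lam powr q\<close> times a radial mass.\<close>

lemma E_functional_eq:
  fixes f :: "'a::euclidean_space \<Rightarrow> real"
  assumes "radial_mass x \<gamma> (radii_above (\<lambda>t. mean_osc r f x t / t) lam q \<gamma>) = ennreal k"
    and "0 \<le> k" "0 < lam" "0 < q"
  shows "E_functional x r f lam q \<gamma> = ennreal ((lam powr q * k) powr (1 / q))"
proof -
  have iff: "y \<in> E_set x r f lam q \<gamma> \<longleftrightarrow> norm (x - y) \<in> radii_above (\<lambda>t. mean_osc r f x t / t) lam q \<gamma>" for y
  proof (cases "y = x")
    \<comment> \<open>At radius 0 the ball is empty and the oscillation is 0, while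
      \<open>radii_above\<close> contains only positive radii.\<close>
    case True
    then show ?thesis
      by (simp add: E_set_def radii_above_def mean_osc_def ball_average_def)
  next
    case False
    then have t: "0 < norm (x - y)" by simp
    then show ?thesis
      by (simp add: E_set_def radii_above_def powr_add field_simps)
  qed
  have "(\<integral>\<^sup>+y\<in>E_set x r f lam q \<gamma>. ennreal (norm (x - y) powr (\<gamma> - real DIM('a))) \<partial>lborel) = ennreal k"
    unfolding assms(1)[symmetric] radial_mass_def
    by (intro nn_integral_cong) (auto simp: indicator_def iff)
  then show ?thesis
    using assms(2-4) by (simp add: E_functional_def ennreal_powr_def powr_mult powr_powr ennreal_mult'[symmetric])
qed

section \<open>The limit of the normalised mass\<close>

text \<open>Below some \<open>\<delta>\<close> the function \<open>g\<close> is within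
  \<open>\<epsilon>\<close> of \<open>L\<close>, and constants have explicit masses. The filter
  \<open>F\<close> covers both signs of \<open>\<gamma>\<close>; they differ only in why the radii
  from \<open>\<delta>\<close> on contribute nothing in the limit.\<close>

lemma radial_mass_radii_above_tendsto:
  fixes x :: "'a::euclidean_space"
  defines "A \<equiv> sphere_measure (sphere (0::'a) 1)"
  assumes \<gamma>q: "\<gamma> \<noteq> 0" "0 < q"
    and g: "\<And>t. 0 < t \<Longrightarrow> 0 \<le> g t" "\<And>t. 0 < t \<Longrightarrow> g t \<le> G" "(g \<longlongrightarrow> L) (at_right 0)"
    and pos: "\<forall>\<^sub>F lam in F. 0 < lam"
    and tail: "\<And>\<delta>. 0 < \<delta> \<Longrightarrow> ((\<lambda>lam. lam powr q *
        enn2real (radial_mass x \<gamma> ({t. 0 < t \<and> t powr (\<gamma> / q) < G / lam} \<inter> {\<delta>..}))) \<longlongrightarrow> 0) F"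
  shows "((\<lambda>lam. lam powr q * enn2real (radial_mass x \<gamma> (radii_above g lam q \<gamma>))) \<longlongrightarrow> A / \<bar>\<gamma>\<bar> * L powr q) F"
proof (rule tendstoI)
  fix e :: real assume e: "0 < e"
  let ?W = "\<lambda>c. {t. 0 < t \<and> t powr (\<gamma> / q) < c}"
  have Wm [measurable]: "?W c \<in> sets borel" for c by measurable
  have A: "0 \<le> A" by (simp add: A_def sphere_measure_unit_sphere_nonneg)
  have ev_pos: "\<forall>\<^sub>F t in at_right (0::real). 0 < t" by (rule eventually_at_right_less)
  have L: "0 \<le> L" "L \<le> G"
    using tendsto_lowerbound[OF g(3), of 0] tendsto_upperbound[OF g(3), of G] eventually_mono[OF ev_pos] g(1,2)
    by auto
  \<comment> \<open>Continuity in the constant yields an \<open>\<epsilon>\<close> for which both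
    explicit values are within \<open>e / 2\<close> of the one for \<open>L\<close>; the other
    \<open>e / 2\<close> is reserved for the tail.\<close>
  have "((\<lambda>\<epsilon>. A / \<bar>\<gamma>\<bar> * (L + \<epsilon>) powr q) \<longlongrightarrow> A / \<bar>\<gamma>\<bar> * (L + 0) powr q) (at_right 0)"
    using L \<gamma>q by (intro tendsto_intros tendsto_powr') (auto intro!: eventually_mono[OF ev_pos])
  from order_tendstoD(2)[OF this, of "A / \<bar>\<gamma>\<bar> * L powr q + e / 2"]
  have up: "\<forall>\<^sub>F \<epsilon> in at_right 0. A / \<bar>\<gamma>\<bar> * (L + \<epsilon>) powr q < A / \<bar>\<gamma>\<bar> * L powr q + e / 2"
    using e by simp
  \<comment> \<open>The lower constant is truncated at 0 because \<open>L - \<epsilon>\<close> may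
    be negative, for instance when \<open>L = 0\<close>.\<close>
  have "((\<lambda>\<epsilon>. A / \<bar>\<gamma>\<bar> * (max 0 (L - \<epsilon>)) powr q) \<longlongrightarrow> A / \<bar>\<gamma>\<bar> * (max 0 (L - 0)) powr q) (at_right 0)"
    using L \<gamma>q by (intro tendsto_intros tendsto_powr' tendsto_max) auto
  from order_tendstoD(1)[OF this, of "A / \<bar>\<gamma>\<bar> * L powr q - e / 2"]
  have lo: "\<forall>\<^sub>F \<epsilon> in at_right 0. A / \<bar>\<gamma>\<bar> * L powr q - e / 2 < A / \<bar>\<gamma>\<bar> * (max 0 (L - \<epsilon>)) powr q"
    using e L by simp
  obtain \<epsilon> where \<epsilon>: "0 < \<epsilon>" "A / \<bar>\<gamma>\<bar> * (L + \<epsilon>) powr q < A / \<bar>\<gamma>\<bar> * L powr q + e / 2"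
      "A / \<bar>\<gamma>\<bar> * L powr q - e / 2 < A / \<bar>\<gamma>\<bar> * (max 0 (L - \<epsilon>)) powr q"
    using eventually_happens[OF eventually_conj[OF ev_pos eventually_conj[OF up lo]]]
    by (auto simp: trivial_limit_at_right_real)
  obtain \<delta> where \<delta>: "0 < \<delta>" "\<And>t. 0 < t \<Longrightarrow> t < \<delta> \<Longrightarrow> \<bar>g t - L\<bar> < \<epsilon>"
    using tendstoD[OF g(3) \<epsilon>(1)] by (auto simp: eventually_at_right_field dist_real_def)
  have ev: "\<forall>\<^sub>F lam in F. lam powr q * enn2real (radial_mass x \<gamma> (?W (G / lam) \<inter> {\<delta>..})) < e / 2"
    using order_tendstoD(2)[OF tail[OF \<delta>(1)], of "e / 2"] e by simp
  show "\<forall>\<^sub>F lam in F. dist (lam powr q * enn2real (radial_mass x \<gamma> (radii_above g lam q \<gamma>))) (A / \<bar>\<gamma>\<bar> * L powr q) < e"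
    using pos ev
  proof eventually_elim
    case (elim lam)
    let ?T = "radii_above g lam q \<gamma>" and ?R = "?W (G / lam) \<inter> {\<delta>..}"
    define k where "k = enn2real (radial_mass x \<gamma> ?T)"
    define m where "m = enn2real (radial_mass x \<gamma> ?R)"
    have G: "0 \<le> G" using L by simp
    have region: "radial_mass x \<gamma> (?W c) = ennreal (A / \<bar>\<gamma>\<bar> * c powr q)" if "0 \<le> c" for c
      unfolding A_def by (rule radial_mass_region[OF \<gamma>q that])
    have scale: "lam powr q * (A / \<bar>\<gamma>\<bar> * (c / lam) powr q) = A / \<bar>\<gamma>\<bar> * c powr q" if "0 \<le> c" for c
      using elim(1) that by (simp add: powr_divide)
    have "radial_mass x \<gamma> ?T < \<infinity>"
      by (rule order_le_less_trans[OF radial_mass_radii_above_le[OF \<gamma>q elim(1) G]]) (use g(2) in auto)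
    then have k: "radial_mass x \<gamma> ?T = ennreal k" "0 \<le> k" by (simp_all add: k_def)
    have "radial_mass x \<gamma> ?R \<le> radial_mass x \<gamma> (?W (G / lam))" by (rule radial_mass_mono) auto
    also have "\<dots> < \<infinity>" using region[of "G / lam"] G elim(1) by simp
    finally have m: "radial_mass x \<gamma> ?R = ennreal m" "0 \<le> m" by (simp_all add: m_def)
    \<comment> \<open>Up to the radii in \<open>?R\<close>, where \<open>g\<close> need not be close to \<open>L\<close>, \<open>?T\<close> lies between the
      regions with constants \<open>L - \<epsilon>\<close> and \<open>L + \<epsilon>\<close>. Only these regions are known to be measurable.\<close>
    have "?T \<subseteq> ?W ((L + \<epsilon>) / lam) \<union> ?R"
    proof
      fix t assume t: "t \<in> ?T"
      show "t \<in> ?W ((L + \<epsilon>) / lam) \<union> ?R"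
      proof (cases "t < \<delta>")
        case True
        with t \<delta>(2)[of t] have "lam * t powr (\<gamma> / q) < L + \<epsilon>" "0 < t" by (auto simp: radii_above_def)
        then show ?thesis using elim(1) by (simp add: field_simps)
      next
        case False
        moreover have "t \<in> ?W (G / lam)"
          using t by (rule subsetD[OF radii_above_subset, rotated -1]) (use elim(1) g(2) in auto)
        ultimately show ?thesis by simp
      qed
    qed
    then have "radial_mass x \<gamma> ?T \<le> radial_mass x \<gamma> (?W ((L + \<epsilon>) / lam) \<union> ?R)" by (rule radial_mass_mono)
    also have "\<dots> \<le> radial_mass x \<gamma> (?W ((L + \<epsilon>) / lam)) + radial_mass x \<gamma> ?R" by (rule radial_mass_Un_le) auto
    finally have "k \<le> A / \<bar>\<gamma>\<bar> * ((L + \<epsilon>) / lam) powr q + m"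
      using region[of "(L + \<epsilon>) / lam"] elim(1) L \<epsilon>(1) A k m by (simp add: ennreal_plus[symmetric] del: ennreal_plus)
    then have "lam powr q * k \<le> lam powr q * (A / \<bar>\<gamma>\<bar> * ((L + \<epsilon>) / lam) powr q + m)" by (rule mult_left_mono) simp
    then have upper: "lam powr q * k \<le> A / \<bar>\<gamma>\<bar> * (L + \<epsilon>) powr q + lam powr q * m"
      using scale[OF add_nonneg_nonneg[OF L(1) less_imp_le[OF \<epsilon>(1)]]] unfolding distrib_left by linarith
    let ?c = "max 0 (L - \<epsilon>)"
    have sub: "?W (?c / lam) - {\<delta>..} \<subseteq> ?T"
    proof
      fix t assume t: "t \<in> ?W (?c / lam) - {\<delta>..}"
      then have t0: "0 < t" "t < \<delta>" "lam * t powr (\<gamma> / q) < ?c" using elim(1) by (auto simp: field_simps)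
      \<comment> \<open>A nonnegative number lies strictly below \<open>?c\<close>, so
        \<open>?c\<close> is positive and equals \<open>L - \<epsilon>\<close>.\<close>
      have "0 \<le> lam * t powr (\<gamma> / q)" using elim(1) by simp
      with t0(3) have "lam * t powr (\<gamma> / q) < L - \<epsilon>" by (simp add: max_def split: if_splits)
      with \<delta>(2)[OF t0(1,2)] have "lam * t powr (\<gamma> / q) < g t" by linarith
      with t0(1) show "t \<in> ?T" by (simp add: radii_above_def)
    qed
    \<comment> \<open>Hence the part of the lower region beyond \<open>\<delta>\<close> is absorbed
      by \<open>?R\<close>.\<close>
    have cG: "?c / lam \<le> G / lam" using L \<epsilon>(1) elim(1) by (intro divide_right_mono) auto
    have "radial_mass x \<gamma> (?W (?c / lam)) \<le> radial_mass x \<gamma> ((?W (?c / lam) - {\<delta>..}) \<union> ?R)"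
      using cG by (intro radial_mass_mono) auto
    also have "\<dots> \<le> radial_mass x \<gamma> (?W (?c / lam) - {\<delta>..}) + radial_mass x \<gamma> ?R" by (rule radial_mass_Un_le) auto
    also have "\<dots> \<le> radial_mass x \<gamma> ?T + radial_mass x \<gamma> ?R"
      by (intro add_right_mono radial_mass_mono sub)
    finally have "A / \<bar>\<gamma>\<bar> * (?c / lam) powr q \<le> k + m"
      using region[of "?c / lam"] elim(1) k m by (simp add: ennreal_plus[symmetric] del: ennreal_plus)
    then have "lam powr q * (A / \<bar>\<gamma>\<bar> * (?c / lam) powr q) \<le> lam powr q * (k + m)" by (rule mult_left_mono) simp
    then have "A / \<bar>\<gamma>\<bar> * ?c powr q \<le> lam powr q * k + lam powr q * m"
      using scale[OF max.cobounded1[of 0 "L - \<epsilon>"]] unfolding distrib_left by linarith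
    with upper \<epsilon>(2,3) elim(2) show ?case
      unfolding k_def[symmetric] m_def[symmetric] dist_real_def by (simp add: abs_less_iff)
  qed
qed

text \<open>The power \<open>t powr (\<gamma> / q)\<close> increases with \<open>t\<close>, so once
  \<open>G / lam\<close> is below its value at \<open>\<delta>\<close> the set is empty.\<close>

lemma radial_tail_tendsto_at_top:
  assumes "0 < \<gamma>" "0 < q" "0 < \<delta>" "0 \<le> G"
  shows "((\<lambda>lam. lam powr q *
    enn2real (radial_mass x \<gamma> ({t. 0 < t \<and> t powr (\<gamma> / q) < G / lam} \<inter> {\<delta>..}))) \<longlongrightarrow> 0) at_top"
proof (rule tendsto_eventually)
  have "\<forall>\<^sub>F lam in at_top. G / \<delta> powr (\<gamma> / q) < lam \<and> 0 < lam"
    by (intro eventually_conj eventually_gt_at_top)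
  then show "\<forall>\<^sub>F lam in at_top. lam powr q *
    enn2real (radial_mass x \<gamma> ({t. 0 < t \<and> t powr (\<gamma> / q) < G / lam} \<inter> {\<delta>..})) = 0"
  proof eventually_elim
    case (elim lam)
    then have "G / lam < \<delta> powr (\<gamma> / q)" using assms by (simp add: field_simps)
    then have "{t. 0 < t \<and> t powr (\<gamma> / q) < G / lam} \<inter> {\<delta>..} = {}"
      using assms powr_mono2[of "\<gamma> / q" \<delta>] by force
    then show ?case by (simp add: radial_mass_def)
  qed
qed

text \<open>For negative \<open>\<gamma>\<close> the mass of \<open>{\<delta>..}\<close> is finite
  and independent of \<open>lam\<close>, and \<open>lam powr q\<close> tends to 0.\<close>

lemma radial_tail_tendsto_at_right_0:
  fixes x :: "'a::euclidean_space"
  assumes "\<gamma> < 0" "0 < q" "0 < \<delta>"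
  shows "((\<lambda>lam. lam powr q *
    enn2real (radial_mass x \<gamma> ({t. 0 < t \<and> t powr (\<gamma> / q) < G / lam} \<inter> {\<delta>..}))) \<longlongrightarrow> 0) (at_right 0)"
proof (rule tendsto_sandwich[where f="\<lambda>_. 0"])
  let ?R = "enn2real (radial_mass x \<gamma> {\<delta>..})"
  show "\<forall>\<^sub>F lam in at_right 0. lam powr q *
    enn2real (radial_mass x \<gamma> ({t. 0 < t \<and> t powr (\<gamma> / q) < G / lam} \<inter> {\<delta>..})) \<le> lam powr q * ?R"
    using radial_mass_atLeast[OF assms(1,3), of x]
    by (intro always_eventually allI mult_left_mono enn2real_mono radial_mass_mono) auto
  have "((\<lambda>lam::real. lam powr q * ?R) \<longlongrightarrow> 0 powr q * ?R) (at_right 0)"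
    using assms(2)
    by (intro tendsto_intros tendsto_powr') (auto intro: eventually_mono[OF eventually_at_right_less])
  then show "((\<lambda>lam. lam powr q * ?R) \<longlongrightarrow> 0) (at_right 0)" by simp
qed auto

section \<open>Limits and uniform bound for the functional\<close>

text \<open>The root of the limit of the normalised mass, computed in the reals and then transferred
  to \<open>ennreal\<close>. Writing \<open>\<bar>\<gamma>\<bar>\<close> gives both signs the same
  right-hand side.\<close>

lemma E_functional_tendsto:
  fixes f :: "real ^ 'n \<Rightarrow> real" and e :: "real ^ 'n"
  assumes f: "C1_compact_support f" and \<gamma>q: "\<gamma> \<noteq> 0" "0 < q" and r: "1 \<le> r" and e: "norm e = 1"
  defines "F \<equiv> if 0 < \<gamma> then at_top else at_right 0"
  shows "((\<lambda>lam. E_functional x r f lam q \<gamma>) \<longlongrightarrow>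
    ennreal (sphere_measure (sphere (0 :: real ^ 'n) 1) powr (1 / q) * K_const e r
      / \<bar>\<gamma>\<bar> powr (1 / q) * norm (grad f x))) F"
proof -
  let ?S = "sphere_measure (sphere (0 :: real ^ 'n) 1)"
  define g where "g = (\<lambda>t. mean_osc r f x t / t)"
  define m where "m = enn2real (HL_maximal (\<lambda>y. norm (grad f y) powr r) x)"
  define G where "G = 2 * m powr (1 / r)"
  define L where "L = K_const e r * norm (grad f x)"
  have M: "HL_maximal (\<lambda>y. norm (grad f y) powr r) x = ennreal m" "0 \<le> m"
    using HL_maximal_grad_finite[OF f, of r x] r by (simp_all add: m_def)
  have g: "0 \<le> g t" "g t \<le> G" if "0 < t" for t
    using mean_osc_div_le[OF f r that M] that by (simp_all add: g_def G_def mean_osc_def)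
  have G: "0 \<le> G" by (simp add: G_def)
  have S: "0 \<le> ?S" by (rule sphere_measure_unit_sphere_nonneg)
  have K: "0 \<le> K_const e r" by (simp add: K_const_def)
  have glim: "(g \<longlongrightarrow> L) (at_right 0)"
    unfolding g_def L_def using mean_osc_div_tendsto[OF f, of r x] r integral_uball_inner_powr[OF e, of r "grad f x"]
    by simp
  have pos: "\<forall>\<^sub>F lam in F. 0 < lam"
    by (simp add: F_def eventually_gt_at_top eventually_at_right_less)
  let ?k = "\<lambda>lam. enn2real (radial_mass x \<gamma> (radii_above g lam q \<gamma>))"
  have "((\<lambda>lam. lam powr q * ?k lam) \<longlongrightarrow> ?S / \<bar>\<gamma>\<bar> * L powr q) F"
  proof (rule radial_mass_radii_above_tendsto[OF \<gamma>q g glim pos])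
    fix \<delta> :: real assume "0 < \<delta>"
    then show "((\<lambda>lam. lam powr q * enn2real (radial_mass x \<gamma>
        ({t. 0 < t \<and> t powr (\<gamma> / q) < G / lam} \<inter> {\<delta>..}))) \<longlongrightarrow> 0) F"
      using \<gamma>q G radial_tail_tendsto_at_top[of \<gamma> q \<delta> G x] radial_tail_tendsto_at_right_0[of \<gamma> q \<delta> x G]
      by (cases \<gamma> "0::real" rule: linorder_cases) (auto simp: F_def)
  qed
  then have "((\<lambda>lam. (lam powr q * ?k lam) powr (1 / q)) \<longlongrightarrow> (?S / \<bar>\<gamma>\<bar> * L powr q) powr (1 / q)) F"
    using \<gamma>q by (intro tendsto_powr') auto
  also have "(?S / \<bar>\<gamma>\<bar> * L powr q) powr (1 / q) = ?S powr (1 / q) * K_const e r / \<bar>\<gamma>\<bar> powr (1 / q) * norm (grad f x)"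
    using S K \<gamma>q(2) by (simp add: powr_mult powr_divide powr_powr L_def)
  finally have "((\<lambda>lam. ennreal ((lam powr q * ?k lam) powr (1 / q))) \<longlongrightarrow>
      ennreal (?S powr (1 / q) * K_const e r / \<bar>\<gamma>\<bar> powr (1 / q) * norm (grad f x))) F"
    by (rule tendsto_ennrealI)
  moreover have "\<forall>\<^sub>F lam in F. ennreal ((lam powr q * ?k lam) powr (1 / q)) = E_functional x r f lam q \<gamma>"
    using pos
  proof eventually_elim
    case (elim lam)
    \<comment> \<open>The mass is finite for each positive \<open>lam\<close>, so
      \<open>enn2real\<close> loses no information.\<close>
    have "radial_mass x \<gamma> (radii_above g lam q \<gamma>) < \<infinity>"
      by (rule order_le_less_trans[OF radial_mass_radii_above_le[OF \<gamma>q elim G]]) (use g(2) in auto)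
    then have "radial_mass x \<gamma> (radii_above g lam q \<gamma>) = ennreal (?k lam)" by simp
    then show ?case
      using E_functional_eq[of x \<gamma> r f lam q "?k lam"] elim \<gamma>q(2) by (simp add: g_def)
  qed
  ultimately show ?thesis by (rule Lim_transform_eventually)
qed

text \<open>The bound \<open>G\<close> on \<open>g\<close> at all radii encloses the level set in
  the explicit region for \<open>G / lam\<close>; the powers of \<open>lam\<close> cancel, which
  makes the estimate uniform in \<open>lam\<close>.\<close>

lemma E_functional_le:
  fixes f :: "'a::euclidean_space \<Rightarrow> real"
  assumes f: "C1_compact_support f" and \<gamma>q: "\<gamma> \<noteq> 0" "0 < q" and r: "1 \<le> r" and lam: "0 < lam"
  shows "E_functional x r f lam q \<gamma> \<le>
    ennreal (2 * sphere_measure (sphere (0 :: 'a) 1) powr (1 / q) * \<bar>\<gamma>\<bar> powr (- 1 / q))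
      * ennreal_powr (HL_maximal (\<lambda>y. norm (grad f y) powr r) x) (1 / r)"
proof -
  let ?S = "sphere_measure (sphere (0 :: 'a) 1)"
  define g where "g = (\<lambda>t. mean_osc r f x t / t)"
  define m where "m = enn2real (HL_maximal (\<lambda>y. norm (grad f y) powr r) x)"
  define G where "G = 2 * m powr (1 / r)"
  have M: "HL_maximal (\<lambda>y. norm (grad f y) powr r) x = ennreal m" "0 \<le> m"
    using HL_maximal_grad_finite[OF f, of r x] r by (simp_all add: m_def)
  have g: "g t \<le> G" if "0 < t" for t
    using mean_osc_div_le[OF f r that M] by (simp add: g_def G_def)
  have G: "0 \<le> G" by (simp add: G_def)
  have S: "0 \<le> ?S" by (rule sphere_measure_unit_sphere_nonneg)
  have le: "radial_mass x \<gamma> (radii_above g lam q \<gamma>) \<le> ennreal (?S / \<bar>\<gamma>\<bar> * (G / lam) powr q)"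
    using g by (intro radial_mass_radii_above_le \<gamma>q lam G)
  then obtain k where k: "radial_mass x \<gamma> (radii_above g lam q \<gamma>) = ennreal k" "0 \<le> k"
    by (cases "radial_mass x \<gamma> (radii_above g lam q \<gamma>)") (auto simp: top_unique)
  have "k \<le> ?S / \<bar>\<gamma>\<bar> * (G / lam) powr q"
    using le S unfolding k(1) by (subst (asm) ennreal_le_iff) auto
  then have "lam powr q * k \<le> lam powr q * (?S / \<bar>\<gamma>\<bar> * (G / lam) powr q)"
    by (rule mult_left_mono) simp
  also have "\<dots> = ?S / \<bar>\<gamma>\<bar> * G powr q"
    using lam G by (simp add: powr_divide)
  finally have "(lam powr q * k) powr (1 / q) \<le> (?S / \<bar>\<gamma>\<bar> * G powr q) powr (1 / q)"
    using k(2) \<gamma>q(2) by (intro powr_mono2) auto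
  also have "\<dots> = 2 * ?S powr (1 / q) * \<bar>\<gamma>\<bar> powr (- 1 / q) * m powr (1 / r)"
    using S G \<gamma>q(2) by (simp add: powr_mult powr_divide powr_powr powr_minus_divide G_def)
  finally have "ennreal ((lam powr q * k) powr (1 / q)) \<le>
      ennreal (2 * ?S powr (1 / q) * \<bar>\<gamma>\<bar> powr (- 1 / q) * m powr (1 / r))"
    by (rule ennreal_leI)
  then show ?thesis
    using E_functional_eq[OF k(1)[unfolded g_def] k(2) lam \<gamma>q(2)] M
    by (simp add: ennreal_powr_def ennreal_mult'[symmetric])
qed

text \<open>The constant \<open>C\<close> is chosen before \<open>f\<close>,
  \<open>\<gamma>\<close>, \<open>q\<close> and \<open>x\<close>, so it can depend only on the
  dimension and \<open>r\<close>.\<close>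

theorem theorem3p9:
  fixes r :: real
  assumes "1 \<le> r"
  shows
    "(\<forall>(f :: real ^ 'n \<Rightarrow> real) (\<gamma>::real) (q::real) (x :: real ^ 'n) (e :: real ^ 'n).
        C1_compact_support f \<and> \<gamma> \<noteq> 0 \<and> 0 < q \<and> norm e = 1 \<longrightarrow>
        (\<gamma> > 0 \<longrightarrow>
          ((\<lambda>lam. E_functional x r f lam q \<gamma>) \<longlongrightarrow>
             ennreal (sphere_measure (sphere (0 :: real ^ 'n) 1) powr (1 / q) * K_const e r
                      / \<gamma> powr (1 / q) * norm (grad f x))) at_top) \<and>
        (\<gamma> < 0 \<longrightarrow>
          ((\<lambda>lam. E_functional x r f lam q \<gamma>) \<longlongrightarrow>
             ennreal (sphere_measure (sphere (0 :: real ^ 'n) 1) powr (1 / q) * K_const e r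
                      / (- \<gamma>) powr (1 / q) * norm (grad f x))) (at_right 0))) \<and>
     (\<exists>C>0. \<forall>(f :: real ^ 'n \<Rightarrow> real) (\<gamma>::real) (q::real) (x :: real ^ 'n).
        C1_compact_support f \<and> \<gamma> \<noteq> 0 \<and> 0 < q \<longrightarrow>
        (SUP lam\<in>{0<..}. E_functional x r f lam q \<gamma>) \<le>
          ennreal (C * sphere_measure (sphere (0 :: real ^ 'n) 1) powr (1 / q)
                   * \<bar>\<gamma>\<bar> powr (- 1 / q))
          * ennreal_powr (HL_maximal (\<lambda>y. norm (grad f y) powr r) x) (1 / r))"
\<comment> \<open>The witness 2 is the factor from the bound on the oscillation by the maximal
  function.\<close>
proof (intro conjI exI[of _ 2] allI impI)
  fix f :: "real ^ 'n \<Rightarrow> real" and \<gamma> q :: real and x e :: "real ^ 'n"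
  assume *: "C1_compact_support f \<and> \<gamma> \<noteq> 0 \<and> 0 < q \<and> norm e = 1"
  then have lim: "((\<lambda>lam. E_functional x r f lam q \<gamma>) \<longlongrightarrow>
    ennreal (sphere_measure (sphere (0 :: real ^ 'n) 1) powr (1 / q) * K_const e r
      / \<bar>\<gamma>\<bar> powr (1 / q) * norm (grad f x))) (if 0 < \<gamma> then at_top else at_right 0)"
    using assms by (intro E_functional_tendsto) auto
  show "((\<lambda>lam. E_functional x r f lam q \<gamma>) \<longlongrightarrow>
    ennreal (sphere_measure (sphere (0 :: real ^ 'n) 1) powr (1 / q) * K_const e r
      / \<gamma> powr (1 / q) * norm (grad f x))) at_top" if "\<gamma> > 0"
    using lim that by simp
  show "((\<lambda>lam. E_functional x r f lam q \<gamma>) \<longlongrightarrow>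
    ennreal (sphere_measure (sphere (0 :: real ^ 'n) 1) powr (1 / q) * K_const e r
      / (- \<gamma>) powr (1 / q) * norm (grad f x))) (at_right 0)" if "\<gamma> < 0"
    using lim that by simp
next
  fix f :: "real ^ 'n \<Rightarrow> real" and \<gamma> q :: real and x :: "real ^ 'n"
  assume "C1_compact_support f \<and> \<gamma> \<noteq> 0 \<and> 0 < q"
  then show "(SUP lam\<in>{0<..}. E_functional x r f lam q \<gamma>) \<le>
      ennreal (2 * sphere_measure (sphere (0 :: real ^ 'n) 1) powr (1 / q) * \<bar>\<gamma>\<bar> powr (- 1 / q))
        * ennreal_powr (HL_maximal (\<lambda>y. norm (grad f y) powr r) x) (1 / r)"
    using assms by (intro SUP_least E_functional_le) auto
qed simp

end
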